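(* Let $A=gl_n^{rsym}$ over a field $\mathcal K$ of characteristic $0$ and let $M=A$ be its regular module. Then the cup product $M\times\mathcal K\to M$, $m\cup\lambda=\lambda m$, induces an isomorphism $$H^{k+1}_{rsym}(A,M)\cong Z^1_{rsym}(A,A)\otimes H^k_{lie}(gl_n,\mathcal K),\qquad Z^1_{rsym}(A,A)\cong sl_n,\qquad k\ge0.$$ In particular, any cocycle class in $H^{k+1}_{rsym}(gl_n,gl_n)$ has a representative that can be presented as $\mathrm{ad}\,X\cup\psi$, where $\psi\in Z^k_{lie}(gl_n,\mathcal K)$.
   Context: $gl_n^{rsym}$ is the algebra of $n\times n$ matrices over $\mathcal K$ with usual product $\circ$, regarded as a right-symmetric algebra; $[a,b]=a\circ b-b\circ a$; the regular module is $A$ with left and right multiplication; $sl_n$ is the space of traceless matrices. Cochains: $C^0_{rsym}(A,A)=\{m:m\circ(a\circ b)=(m\circ a)\circ b\ \forall a,b\}$, $C^{k+1}_{rsym}(A,A)=\mathrm{Hom}(A\otimes\wedge^kA,A)$, $k\ge0$, with $d_{rsym}m(a)=a\circ m-m\circ a$ and, for $\psi\in C^k_{rsym}(A,A)$, $k\ge1$, $$d_{rsym}\psi(a_0,\ldots,a_k)=\sum_{i=1}^k(-1)^{i+1}\{a_0\circ\psi(a_i,a_1,..,\widehat{a_i},..,a_k)-\psi(a_0\circ a_i,a_1,..,\widehat{a_i},..,a_k)+\psi(a_0,a_1,..,\widehat{a_i},..,a_k)\circ a_i\}$$ $$+\sum_{1\le i<j\le k}(-1)^{i+1}\psi(a_0,a_1,..,\widehat{a_i},..,a_{j-1},[a_i,a_j],..,a_k).$$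 $Z^k_{rsym},H^k_{rsym}$ are cocycles and cohomology (so $Z^1_{rsym}(A,A)$ is the space of derivations of the matrix algebra). $Z^k_{lie}(gl_n,\mathcal K)$, $H^k_{lie}(gl_n,\mathcal K)$ are Chevalley–Eilenberg cocycles and cohomology with trivial coefficients. $\mathrm{ad}\,X(a)=[X,a]$, $X\in sl_n$. For $f\in Z^1_{rsym}(A,A)$ and $\psi\in Z^k_{lie}(gl_n,\mathcal K)$, $(f\cup\psi)(a_0,a_1,\ldots,a_k)=\psi(a_1,\ldots,a_k)f(a_0)$; the induced map is $f\otimes[\psi]\mapsto[f\cup\psi]$.
   Formalization: For k=0, H^1_rsym is replaced by Z^1_rsym, since H^1_rsym=0 while sl_n is nonzero for n≥2; representatives are finite sums of cochains ad X_i ∪ ψ_i, since a single ad X ∪ ψ does not suffice, e.g. for n=4, k=8, where H^8_lie has dimension 2. *)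

theory Defs
  imports
    "HOL-Analysis.Determinants"
    "HOL-Library.Function_Algebras"
    "HOL-Library.Set_Algebras"
    "HOL-Library.Poly_Mapping"
begin

section \<open>Vector spaces with explicit carrier, quotients, tensor products\<close>

text \<open>Cohomology spaces are quotients of subspaces and hence not types, so their linear
  structure is carried by a record.\<close>

record ('k, 'v) vspace =
  vcarrier :: "'v set"
  vadd :: "'v \<Rightarrow> 'v \<Rightarrow> 'v"
  vscale :: "'k \<Rightarrow> 'v \<Rightarrow> 'v"

definition vlinear :: "('k, 'v) vspace \<Rightarrow> ('k, 'w) vspace \<Rightarrow> ('v \<Rightarrow> 'w) \<Rightarrow> bool" where
  "vlinear V W f \<longleftrightarrow>
     (\<forall>x \<in> vcarrier V. f x \<in> vcarrier W) \<and>
     (\<forall>x \<in> vcarrier V. \<forall>y \<in> vcarrier V. f (vadd V x y) = vadd W (f x) (f y)) \<and>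
     (\<forall>c. \<forall>x \<in> vcarrier V. f (vscale V c x) = vscale W c (f x))"

definition viso :: "('k, 'v) vspace \<Rightarrow> ('k, 'w) vspace \<Rightarrow> ('v \<Rightarrow> 'w) \<Rightarrow> bool" where
  "viso V W f \<longleftrightarrow> vlinear V W f \<and> bij_betw f (vcarrier V) (vcarrier W)"

definition vsub :: "('k \<Rightarrow> 'v \<Rightarrow> 'v) \<Rightarrow> 'v set \<Rightarrow> ('k, 'v::ab_group_add) vspace" where
  "vsub s Z = \<lparr>vcarrier = Z, vadd = (+), vscale = s\<rparr>"

text \<open>The quotient of a subspace \<open>Z\<close> by a subspace \<open>B\<close>: its elements are the cosets
  \<open>z +o B\<close>. The union in the scaling only ranges over equal cosets; it avoids choosing a
  representative (and is correct for the scalar 0, where the image of \<open>X\<close> would be \<open>{0}\<close>).\<close>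

definition vquot ::
  "('k \<Rightarrow> 'v \<Rightarrow> 'v) \<Rightarrow> 'v set \<Rightarrow> 'v set \<Rightarrow> ('k, 'v::ab_group_add set) vspace" where
  "vquot s Z B =
     \<lparr>vcarrier = (\<lambda>z. z +o B) ` Z,
      vadd = (\<lambda>X Y. X + Y),
      vscale = (\<lambda>c X. \<Union>x\<in>X. s c x +o B)\<rparr>"

text \<open>The tensor product is the space of finitely supported functions on
  \<open>vcarrier V \<times> vcarrier W\<close> modulo the bilinearity relations.\<close>

definition free_scale :: "'k::field \<Rightarrow> ('a \<Rightarrow>\<^sub>0 'k) \<Rightarrow> ('a \<Rightarrow>\<^sub>0 'k)" where
  "free_scale c p = Poly_Mapping.map ((*) c) p"

definition tensor_rels ::
  "('k::field, 'v) vspace \<Rightarrow> ('k, 'w) vspace \<Rightarrow> ('v \<times> 'w \<Rightarrow>\<^sub>0 'k) set" where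
  "tensor_rels V W = module.span free_scale
     ({Poly_Mapping.single (vadd V x x', y) 1 - Poly_Mapping.single (x, y) 1
         - Poly_Mapping.single (x', y) 1 | x x' y.
         x \<in> vcarrier V \<and> x' \<in> vcarrier V \<and> y \<in> vcarrier W} \<union>
      {Poly_Mapping.single (x, vadd W y y') 1 - Poly_Mapping.single (x, y) 1
         - Poly_Mapping.single (x, y') 1 | x y y'.
         x \<in> vcarrier V \<and> y \<in> vcarrier W \<and> y' \<in> vcarrier W} \<union>
      {Poly_Mapping.single (vscale V c x, y) 1 - Poly_Mapping.single (x, y) c | c x y.
         x \<in> vcarrier V \<and> y \<in> vcarrier W} \<union>
      {Poly_Mapping.single (x, vscale W c y) 1 - Poly_Mapping.single (x, y) c | c x y.
         x \<in> vcarrier V \<and> y \<in> vcarrier W})"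

definition tensor ::
  "('k::field, 'v) vspace \<Rightarrow> ('k, 'w) vspace \<Rightarrow> ('k, ('v \<times> 'w \<Rightarrow>\<^sub>0 'k) set) vspace" where
  "tensor V W =
     vquot free_scale {p. Poly_Mapping.keys p \<subseteq> vcarrier V \<times> vcarrier W} (tensor_rels V W)"

definition pure_tensor ::
  "('k::field, 'v) vspace \<Rightarrow> ('k, 'w) vspace \<Rightarrow> 'v \<Rightarrow> 'w \<Rightarrow> ('v \<times> 'w \<Rightarrow>\<^sub>0 'k) set" where
  "pure_tensor V W x y = Poly_Mapping.single (x, y) 1 +o tensor_rels V W"


section \<open>Matrices\<close>

definition mscale :: "'k::times \<Rightarrow> 'k ^ 'n ^ 'm \<Rightarrow> 'k ^ 'n ^ 'm" where
  "mscale c A = (\<chi> i j. c * A $ i $ j)"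

definition br :: "'k::ring_1 ^ 'n ^ 'n \<Rightarrow> 'k ^ 'n ^ 'n \<Rightarrow> 'k ^ 'n ^ 'n" where
  "br a b = a ** b - b ** a"

definition sl :: "('k::ring_1 ^ 'n ^ 'n) set" where
  "sl = {X. trace X = 0}"


section \<open>Cochains\<close>

text \<open>A map with \<open>k\<close> arguments is a function on lists which vanishes on lists of length
  other than \<open>k\<close>; cochains of degree 0 are thus determined by their value at \<open>[]\<close>.\<close>

definition fscale :: "('k \<Rightarrow> 'v \<Rightarrow> 'v) \<Rightarrow> 'k \<Rightarrow> ('a \<Rightarrow> 'v) \<Rightarrow> ('a \<Rightarrow> 'v)" where
  "fscale s c f = (\<lambda>x. s c (f x))"

definition multilinear ::
  "('k::field \<Rightarrow> 'v::ab_group_add \<Rightarrow> 'v) \<Rightarrow> nat \<Rightarrow> (('k ^ 'n ^ 'n) list \<Rightarrow> 'v) \<Rightarrow> bool" where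
  "multilinear s k \<psi> \<longleftrightarrow>
     (\<forall>as. length as \<noteq> k \<longrightarrow> \<psi> as = 0) \<and>
     (\<forall>as i. length as = k \<and> i < k \<longrightarrow>
        Vector_Spaces.linear mscale s (\<lambda>x. \<psi> (as[i := x])))"

definition alternating_from :: "nat \<Rightarrow> ('a list \<Rightarrow> 'v::zero) \<Rightarrow> bool" where
  "alternating_from l \<psi> \<longleftrightarrow>
     (\<forall>as i j. l \<le> i \<and> i < j \<and> j < length as \<and> as ! i = as ! j \<longrightarrow> \<psi> as = 0)"

definition del :: "nat \<Rightarrow> 'a list \<Rightarrow> 'a list" where
  "del i as = take i as @ drop (Suc i) as"


subsection \<open>The right-symmetric complex of the matrix algebra with regular coefficients\<close>

definition rsym_C :: "nat \<Rightarrow> (('k::field ^ 'n ^ 'n) list \<Rightarrow> 'k ^ 'n ^ 'n) set" where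
  "rsym_C k =
     (if k = 0
      then {\<psi>. multilinear mscale 0 \<psi> \<and>
            (\<forall>a b :: 'k ^ 'n ^ 'n. \<psi> [] ** (a ** b) = (\<psi> [] ** a) ** b)}
      else {\<psi>. multilinear mscale k \<psi> \<and> alternating_from 1 \<psi>})"

text \<open>The list \<open>as\<close> is \<open>[a\<^sub>0, \<dots>, a\<^sub>k]\<close>. For \<open>1 \<le> i\<close> the list \<open>tl (del i as)\<close> consists of
  \<open>a\<^sub>1, \<dots>, a\<^sub>k\<close> without \<open>a\<^sub>i\<close>. The degree of \<open>\<psi>\<close> need not be given, as \<open>\<psi>\<close> vanishes on lists of
  the wrong length.\<close>

definition rsym_d ::
  "(('k::field ^ 'n ^ 'n) list \<Rightarrow> 'k ^ 'n ^ 'n) \<Rightarrow> ('k ^ 'n ^ 'n) list \<Rightarrow> 'k ^ 'n ^ 'n" where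
  "rsym_d \<psi> as =
     (if length as = 1 then as ! 0 ** \<psi> [] - \<psi> [] ** as ! 0
      else
        (\<Sum>i = 1..<length as. mscale ((-1) ^ (i + 1))
           (as ! 0 ** \<psi> (as ! i # tl (del i as))
            - \<psi> ((as ! 0 ** as ! i) # tl (del i as))
            + \<psi> (del i as) ** as ! i))
        + (\<Sum>i = 1..<length as. \<Sum>j = i + 1..<length as. mscale ((-1) ^ (i + 1))
             (\<psi> (del i (as[j := br (as ! i) (as ! j)])))))"

definition rsym_Z :: "nat \<Rightarrow> (('k::field ^ 'n ^ 'n) list \<Rightarrow> 'k ^ 'n ^ 'n) set" where
  "rsym_Z k = {\<psi> \<in> rsym_C k. rsym_d \<psi> = 0}"

definition rsym_B :: "nat \<Rightarrow> (('k::field ^ 'n ^ 'n) list \<Rightarrow> 'k ^ 'n ^ 'n) set" where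
  "rsym_B k = (case k of 0 \<Rightarrow> {0} | Suc l \<Rightarrow> rsym_d ` rsym_C l)"

definition rsym_Z_space ::
  "nat \<Rightarrow> ('k::field, ('k ^ 'n ^ 'n) list \<Rightarrow> 'k ^ 'n ^ 'n) vspace" where
  "rsym_Z_space k = vsub (fscale mscale) (rsym_Z k)"

definition rsym_H ::
  "nat \<Rightarrow> ('k::field, (('k ^ 'n ^ 'n) list \<Rightarrow> 'k ^ 'n ^ 'n) set) vspace" where
  "rsym_H k = vquot (fscale mscale) (rsym_Z k) (rsym_B k)"


subsection \<open>The Chevalley--Eilenberg complex of \<open>gl\<^sub>n\<close> with trivial coefficients\<close>

definition lie_C :: "nat \<Rightarrow> (('k::field ^ 'n ^ 'n) list \<Rightarrow> 'k) set" where
  "lie_C k = {\<psi>. multilinear (*) k \<psi> \<and> alternating_from 0 \<psi>}"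

text \<open>As in the right-symmetric complex, the bracket replaces the argument at position \<open>j\<close>. By
  alternation this is the textbook differential (with the bracket moved to the front and sign
  \<open>(-1)\<^sup>i\<^sup>+\<^sup>j\<close>) up to an overall factor -1, which affects neither cocycles nor coboundaries.
  Positions start at 0 here, so that the sign is \<open>(-1)\<^sup>i\<close>.\<close>

definition lie_d ::
  "(('k::field ^ 'n ^ 'n) list \<Rightarrow> 'k) \<Rightarrow> ('k ^ 'n ^ 'n) list \<Rightarrow> 'k" where
  "lie_d \<psi> as =
     (\<Sum>i = 0..<length as. \<Sum>j = i + 1..<length as.
        (-1) ^ i * \<psi> (del i (as[j := br (as ! i) (as ! j)])))"

definition lie_Z :: "nat \<Rightarrow> (('k::field ^ 'n ^ 'n) list \<Rightarrow> 'k) set" where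
  "lie_Z k = {\<psi> \<in> lie_C k. lie_d \<psi> = 0}"

definition lie_B :: "nat \<Rightarrow> (('k::field ^ 'n ^ 'n) list \<Rightarrow> 'k) set" where
  "lie_B k = (case k of 0 \<Rightarrow> {0} | Suc l \<Rightarrow> lie_d ` lie_C l)"

definition lie_H :: "nat \<Rightarrow> ('k::field, (('k ^ 'n ^ 'n) list \<Rightarrow> 'k) set) vspace" where
  "lie_H k = vquot (fscale (*)) (lie_Z k) (lie_B k)"


subsection \<open>Cup product and inner derivations\<close>

definition cup ::
  "(('k::field ^ 'n ^ 'n) list \<Rightarrow> 'k ^ 'n ^ 'n) \<Rightarrow> (('k ^ 'n ^ 'n) list \<Rightarrow> 'k) \<Rightarrow>
   ('k ^ 'n ^ 'n) list \<Rightarrow> 'k ^ 'n ^ 'n" where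
  "cup f \<psi> as = (case as of [] \<Rightarrow> 0 | a\<^sub>0 # bs \<Rightarrow> mscale (\<psi> bs) (f [a\<^sub>0]))"

definition ad :: "'k::field ^ 'n ^ 'n \<Rightarrow> ('k ^ 'n ^ 'n) list \<Rightarrow> 'k ^ 'n ^ 'n" where
  "ad X as = (if length as = 1 then br X (as ! 0) else 0)"

text \<open>\<open>\<Phi>\<close> is the map \<open>f \<otimes> [\<psi>] \<mapsto> [f \<union> \<psi>]\<close>, where \<open>cls\<close> is the passage to classes in the
  target; a linear map out of the tensor product is determined by this condition.\<close>

definition induced_by_cup ::
  "nat \<Rightarrow> ((('k::field ^ 'n ^ 'n) list \<Rightarrow> 'k ^ 'n ^ 'n) \<Rightarrow> 'c) \<Rightarrow>
   ((((('k ^ 'n ^ 'n) list \<Rightarrow> 'k ^ 'n ^ 'n) \<times> (('k ^ 'n ^ 'n) list \<Rightarrow> 'k) set) \<Rightarrow>\<^sub>0 'k) set \<Rightarrow> 'c) \<Rightarrow>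
   bool" where
  "induced_by_cup k cls \<Phi> \<longleftrightarrow>
     (\<forall>f \<in> rsym_Z 1. \<forall>\<psi> \<in> lie_Z k.
        \<Phi> (pure_tensor (rsym_Z_space 1) (lie_H k) f (\<psi> +o lie_B k)) = cls (cup f \<psi>))"

end

theory Submission
  imports Defs
begin

text \<open>
  In its first argument a right-symmetric cochain \<open>\<psi>(a\<^sub>0, a\<^sub>1, \<dots>, a\<^sub>k)\<close> is a linear endomorphism of the
  matrix algebra \<open>A\<close>, and in the other arguments it alternates. The formula for the
  right-symmetric differential says that the complex in positive degrees is the
  Chevalley--Eilenberg complex of \<open>gl\<^sub>n\<close> with coefficients in the right module \<open>End A\<close> with the action
  \<open>(f \<cdot> a)(u) = u f(a) - f(u a) + f(u) a\<close> (\<open>rsym_C_Suc_iff\<close>, \<open>rsym_d_Cons\<close>). Its invariants are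
  the derivations. For a reductive Lie algebra and a suitable module, the cohomology is that of the
  trivial module tensored with the invariants, and this is the theorem.

  The proof makes the projection onto the invariants explicit. There is an invariant map
  \<open>slpart : End A \<rightarrow> sl\<^sub>n\<close> that is inverse to \<open>X \<mapsto> [X, -]\<close> on derivations; let
  \<open>P f = [slpart f, -]\<close> be the resulting projection onto derivations. A computation with matrix units
  gives \<open>1 = P + C / 2n + T / 2\<close> on \<open>End A\<close>, where \<open>C\<close> is the Casimir operator for the trace
  form and \<open>T\<close> is the action of the identity matrix (\<open>endo_decomposition\<close>). On cocycles
  both \<open>C\<close> and \<open>T\<close> are null-homotopic: \<open>T\<close> by contraction with the central identity matrix
  (\<open>central_homotopy\<close>), and \<open>C\<close> by the homotopy of Whitehead's lemma (\<open>casimir_homotopy\<close>). Hence every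
  cocycle is cohomologous to its image under \<open>P\<close>, which is visibly a sum of cup products
  \<open>ad X \<union> \<psi>\<close> (\<open>homotopy_formula\<close>).

  The cup product with a derivation and the entries of \<open>slpart\<close> are chain maps between the two
  complexes (\<open>rsym_d_cup\<close>, \<open>sl_component_rsym_d\<close>), since they are composition with equivariant maps of
  coefficients. On derivations the entries of \<open>slpart\<close> are coordinates with respect to the
  spanning family of the \<open>ad E\<close>, for \<open>E\<close> the traceless parts of the matrix units. So they
  provide the inverse of the map on the tensor product; that this suffices is the linear algebra of
  \<open>tensor_viso_of_frame\<close>.\<close>

section \<open>Linear maps between quotient spaces\<close>

lemma (in module) coset_eq_iff:
  assumes "subspace B"
  shows "x +o B = y +o B \<longleftrightarrow> x - y \<in> B"
proof
  assume "x +o B = y +o B"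
  moreover have "x \<in> x +o B"
    using set_plus_intro2[OF subspace_0[OF assms], of x] by simp
  ultimately show "x - y \<in> B"
    by (simp add: set_minus_plus)
next
  assume xy: "x - y \<in> B"
  show "x +o B = y +o B"
  proof (intro set_eqI)
    fix z
    have "z - x \<in> B \<longleftrightarrow> z - y \<in> B"
      using subspace_add[OF assms _ xy, of "z - x"] subspace_diff[OF assms _ xy, of "z - y"]
      by auto
    then show "z \<in> x +o B \<longleftrightarrow> z \<in> y +o B"
      by (simp add: set_minus_plus)
  qed
qed

lemma (in module) coset_add:
  assumes "subspace B"
  shows "(x +o B) + (y +o B) = (x + y) +o B"
proof -
  have "B + B = B"
    using subspace_add[OF assms] set_zero_plus2[OF subspace_0[OF assms], of B]
    by (fastforce simp: set_plus_def)
  then show ?thesis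
    by (simp add: set_plus_rearrange)
qed

lemma (in module) coset_scale:
  assumes "subspace B"
  shows "(\<Union>x' \<in> x +o B. scale c x' +o B) = scale c x +o B"
proof -
  have "scale c x' +o B = scale c x +o B" if "x' \<in> x +o B" for x'
    using subspace_scale[OF assms, of "x' - x" c] that
    by (simp add: coset_eq_iff[OF assms] set_minus_plus[symmetric] scale_right_diff_distrib)
  moreover have "x \<in> x +o B"
    using set_plus_intro2[OF subspace_0[OF assms], of x] by simp
  ultimately show ?thesis
    by blast
qed

text \<open>All hypotheses concern the map \<open>f\<close> between the ambient spaces. A map out of a tensor product can
thus be studied on the free space that the tensor product is a quotient of, where it is given by
a formula.\<close>

lemma (in module_hom) viso_vquot:
  assumes B1: "m1.subspace B1" and B2: "m2.subspace B2"
    and Z: "f ` Z1 \<subseteq> Z2" and B: "f ` B1 \<subseteq> B2"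
    and kernel: "\<And>x. x \<in> Z1 \<Longrightarrow> f x \<in> B2 \<Longrightarrow> x \<in> B1"
    and Z1: "m1.subspace Z1"
    and image: "\<And>y. y \<in> Z2 \<Longrightarrow> \<exists>x \<in> Z1. y - f x \<in> B2"
  shows "\<exists>\<Phi>. viso (vquot s1 Z1 B1) (vquot s2 Z2 B2) \<Phi> \<and> (\<forall>x. \<Phi> (x +o B1) = f x +o B2)"
proof -
  define \<Phi> where "\<Phi> X = (\<Union>x\<in>X. f x +o B2)" for X
  have \<Phi>: "\<Phi> (x +o B1) = f x +o B2" for x
  proof -
    have "f x' +o B2 = f x +o B2" if "x' \<in> x +o B1" for x'
      using that B by (auto simp: m2.coset_eq_iff[OF B2] set_minus_plus[symmetric] diff[symmetric])
    moreover have "x \<in> x +o B1"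
      using set_plus_intro2[OF m1.subspace_0[OF B1], of x] by simp
    ultimately show ?thesis
      unfolding \<Phi>_def by blast
  qed
  have "vlinear (vquot s1 Z1 B1) (vquot s2 Z2 B2) \<Phi>"
    using Z by (auto simp: vlinear_def vquot_def m1.coset_add[OF B1] m2.coset_add[OF B2]
        m1.coset_scale[OF B1] m2.coset_scale[OF B2] \<Phi> add scale)
  moreover have "inj_on \<Phi> ((\<lambda>z. z +o B1) ` Z1)"
  proof (rule inj_onI, clarsimp simp: \<Phi> m1.coset_eq_iff[OF B1] m2.coset_eq_iff[OF B2])
    fix x y
    assume "x \<in> Z1" "y \<in> Z1" "f x - f y \<in> B2"
    then show "x - y \<in> B1"
      by (intro kernel) (auto simp: diff m1.subspace_diff[OF Z1])
  qed
  moreover have "\<Phi> ` (\<lambda>z. z +o B1) ` Z1 = (\<lambda>z. z +o B2) ` Z2"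
  proof
    show "\<Phi> ` (\<lambda>z. z +o B1) ` Z1 \<subseteq> (\<lambda>z. z +o B2) ` Z2"
      using Z by (auto simp: \<Phi>)
    show "(\<lambda>z. z +o B2) ` Z2 \<subseteq> \<Phi> ` (\<lambda>z. z +o B1) ` Z1"
    proof clarify
      fix y assume "y \<in> Z2"
      then obtain x where "x \<in> Z1" "y - f x \<in> B2"
        using image by blast
      then show "y +o B2 \<in> \<Phi> ` (\<lambda>z. z +o B1) ` Z1"
        by (auto simp: image_image \<Phi> m2.coset_eq_iff[OF B2] image_iff)
    qed
  qed
  ultimately show ?thesis
    using \<Phi> by (auto simp: viso_def bij_betw_def vquot_def)
qed

section \<open>The tensor product\<close>

lemma lookup_free_scale [simp]: "Poly_Mapping.lookup (free_scale c p) x = c * Poly_Mapping.lookup p x"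
  by (simp add: free_scale_def Poly_Mapping.map.rep_eq when_def)

lemma free_scale_single [simp]: "free_scale c (Poly_Mapping.single x d) = Poly_Mapping.single x (c * d)"
  by (rule poly_mapping_eqI) (simp add: lookup_single when_def)

lemma keys_free_scale: "Poly_Mapping.keys (free_scale c p) \<subseteq> Poly_Mapping.keys p"
  by (auto simp: in_keys_iff)

interpretation free: vector_space free_scale
  by unfold_locales (auto intro!: poly_mapping_eqI simp: lookup_add algebra_simps)

definition linear_extension ::
  "('k::field \<Rightarrow> 'u \<Rightarrow> 'u) \<Rightarrow> ('a \<Rightarrow> 'u) \<Rightarrow> ('a \<Rightarrow>\<^sub>0 'k) \<Rightarrow> 'u::ab_group_add" where
  "linear_extension s r p = (\<Sum>x \<in> Poly_Mapping.keys p. s (Poly_Mapping.lookup p x) (r x))"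

lemma (in vector_space) linear_extension_eq:
  assumes "finite A" "Poly_Mapping.keys p \<subseteq> A"
  shows "linear_extension scale r p = (\<Sum>x\<in>A. scale (Poly_Mapping.lookup p x) (r x))"
  unfolding linear_extension_def
  by (rule sum.mono_neutral_left) (use assms in \<open>auto simp: in_keys_iff\<close>)

lemma (in vector_space) linear_extension_single [simp]:
  "linear_extension scale r (Poly_Mapping.single x c) = scale c (r x)"
  by (simp add: linear_extension_def)

lemma (in vector_space) module_hom_linear_extension:
  "module_hom free_scale scale (linear_extension scale r)"
proof -
  have "linear_extension scale r (p + q) = linear_extension scale r p + linear_extension scale r q" for p q
    using keys_add[of p q]
    by (simp add: linear_extension_eq[of "Poly_Mapping.keys p \<union> Poly_Mapping.keys q"] lookup_add scale_left_distrib sum.distrib)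
  moreover have "linear_extension scale r (free_scale c p) = scale c (linear_extension scale r p)" for c p
    by (subst (1 2) linear_extension_eq[of "Poly_Mapping.keys p"]) (auto simp: in_keys_iff scale_sum_right)
  ultimately show ?thesis
    by (simp add: module_hom_iff free.module_axioms module_axioms)
qed

lemma poly_mapping_eq_sum_single: "p = (\<Sum>x \<in> Poly_Mapping.keys p. Poly_Mapping.single x (Poly_Mapping.lookup p x))"
  by (rule poly_mapping_eqI) (simp add: lookup_sum lookup_single when_def in_keys_iff)

lemma sum_congruent_mod_subspace:
  assumes S: "module s" and B: "module.subspace s B" and "\<And>x. x \<in> A \<Longrightarrow> f x - g x \<in> B"
  shows "sum f A - sum g A \<in> B"
  using module.subspace_sum[OF S B, of A "\<lambda>x. f x - g x"] assms(3) by (simp add: sum_subtractf)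

text \<open>The embedding \<open>x \<mapsto> (x, y)\<close> of a factor into the free space is linear only up to the
  bilinearity relations.\<close>

lemma linear_mod_subspace_sum:
  assumes "vector_space s1" "vector_space s2" and Z: "module.subspace s1 Z" and B: "module.subspace s2 B"
    and add: "\<And>x y. x \<in> Z \<Longrightarrow> y \<in> Z \<Longrightarrow> g (x + y) - g x - g y \<in> B"
    and scale: "\<And>c x. x \<in> Z \<Longrightarrow> g (s1 c x) - s2 c (g x) \<in> B"
    and A: "finite A" "\<And>i. i \<in> A \<Longrightarrow> x i \<in> Z"
  shows "g (\<Sum>i\<in>A. s1 (c i) (x i)) - (\<Sum>i\<in>A. s2 (c i) (g (x i))) \<in> B"
proof -
  interpret m1: vector_space s1 by fact
  interpret m2: vector_space s2 by fact
  show ?thesis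
    using A
  proof (induction A rule: finite_induct)
    case empty
    show ?case
      using scale[OF m1.subspace_0[OF Z], of 0] by simp
  next
    case (insert i A)
    let ?u = "s1 (c i) (x i)" and ?v = "\<Sum>i\<in>A. s1 (c i) (x i)"
    have "?u \<in> Z" "?v \<in> Z"
      using insert.prems by (auto intro!: m1.subspace_sum[OF Z] m1.subspace_scale[OF Z])
    then have "g (?u + ?v) - g ?u - g ?v \<in> B"
      by (rule add)
    moreover have "g ?u - s2 (c i) (g (x i)) \<in> B"
      using insert.prems by (intro scale) auto
    moreover have "g ?v - (\<Sum>i\<in>A. s2 (c i) (g (x i))) \<in> B"
      using insert by auto
    ultimately have "(g (?u + ?v) - g ?u - g ?v) + ((g ?u - s2 (c i) (g (x i))) +
        (g ?v - (\<Sum>i\<in>A. s2 (c i) (g (x i))))) \<in> B"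
      by (intro m2.subspace_add[OF B])
    then show ?case
      using insert.hyps by (simp add: algebra_simps)
  qed
qed

lemma tensor_rels_generators:
  assumes "x \<in> vcarrier V" "y \<in> vcarrier W"
  shows "x' \<in> vcarrier V \<Longrightarrow> Poly_Mapping.single (vadd V x x', y) 1 - Poly_Mapping.single (x, y) 1
      - Poly_Mapping.single (x', y) 1 \<in> tensor_rels V W"
    and "y' \<in> vcarrier W \<Longrightarrow> Poly_Mapping.single (x, vadd W y y') 1 - Poly_Mapping.single (x, y) 1
      - Poly_Mapping.single (x, y') 1 \<in> tensor_rels V W"
    and "Poly_Mapping.single (vscale V c x, y) 1 - Poly_Mapping.single (x, y) c \<in> tensor_rels V W"
    and "Poly_Mapping.single (x, vscale W c y) 1 - Poly_Mapping.single (x, y) c \<in> tensor_rels V W"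
  unfolding tensor_rels_def using assms
  by (intro free.span_base UnI1 CollectI exI conjI refl; assumption |
      blast intro: free.span_base)+

text \<open>A frame of \<open>V\<close> is a finite spanning family \<open>b\<close> with linear coordinates \<open>e\<close> that reproduce every
vector; it may be redundant. Suppose that every coordinate \<open>e i\<close> extends to a map \<open>\<kappa> i\<close> on the
target of the pairing \<open>\<beta>\<close>, in the sense that \<open>\<kappa> i (\<beta> x w) = e i x \<cdot> w\<close>. Then
\<open>\<eta> \<mapsto> \<Sum>\<^sub>i b i \<otimes> \<kappa> i \<eta>\<close> is inverse to the map that \<open>\<beta>\<close> induces on \<open>V \<otimes> W\<close>: one composite sends
\<open>x \<otimes> w\<close> to \<open>\<Sum>\<^sub>i b i \<otimes> e i x \<cdot> w = (\<Sum>\<^sub>i e i x \<cdot> b i) \<otimes> w = x \<otimes> w\<close>, and that the other is the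
identity modulo \<open>BU\<close> is the last hypothesis.\<close>

lemma tensor_viso_of_frame:
  fixes sV :: "'k::field \<Rightarrow> 'v::ab_group_add \<Rightarrow> 'v" and sW :: "'k \<Rightarrow> 'w::ab_group_add \<Rightarrow> 'w"
    and sU :: "'k \<Rightarrow> 'u::ab_group_add \<Rightarrow> 'u"
  assumes V: "vector_space sV" and W: "vector_space sW" and U: "vector_space sU"
    and ZV: "module.subspace sV ZV" and ZW: "module.subspace sW ZW" and BW: "module.subspace sW BW"
    and ZU: "module.subspace sU ZU" and BU: "module.subspace sU BU"
    and \<beta>1: "\<And>w. module_hom sV sU (\<lambda>x. \<beta> x w)" and \<beta>2: "\<And>x. module_hom sW sU (\<beta> x)"
    and \<beta>_Z: "\<And>x w. x \<in> ZV \<Longrightarrow> w \<in> ZW \<Longrightarrow> \<beta> x w \<in> ZU"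
    and \<beta>_B: "\<And>x w. x \<in> ZV \<Longrightarrow> w \<in> BW \<Longrightarrow> \<beta> x w \<in> BU"
    and I: "finite I" and b: "\<And>i. i \<in> I \<Longrightarrow> b i \<in> ZV"
    and frame: "\<And>x. x \<in> ZV \<Longrightarrow> x = (\<Sum>i\<in>I. sV (e i x) (b i))"
    and \<kappa>: "\<And>i. module_hom sU sW (\<kappa> i)"
    and \<kappa>_Z: "\<And>i \<eta>. i \<in> I \<Longrightarrow> \<eta> \<in> ZU \<Longrightarrow> \<kappa> i \<eta> \<in> ZW"
    and \<kappa>_B: "\<And>i \<eta>. i \<in> I \<Longrightarrow> \<eta> \<in> BU \<Longrightarrow> \<kappa> i \<eta> \<in> BW"
    and \<kappa>\<beta>: "\<And>i x w. \<kappa> i (\<beta> x w) = sW (e i x) w"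
    and \<beta>\<kappa>: "\<And>\<eta>. \<eta> \<in> ZU \<Longrightarrow> \<eta> - (\<Sum>i\<in>I. \<beta> (b i) (\<kappa> i \<eta>)) \<in> BU"
  defines "T \<equiv> tensor (vsub sV ZV) (vquot sW ZW BW)"
  shows "\<exists>\<Phi>. viso T (vquot sU ZU BU) \<Phi> \<and>
    (\<forall>x \<in> ZV. \<forall>w \<in> ZW. \<Phi> (pure_tensor (vsub sV ZV) (vquot sW ZW BW) x (w +o BW)) = \<beta> x w +o BU)"
proof -
  interpret V: vector_space sV by fact
  interpret W: vector_space sW by fact
  interpret U: vector_space sU by fact
  interpret \<beta>1: module_hom sV sU "\<lambda>x. \<beta> x w" for w by (rule \<beta>1)
  interpret \<beta>2: module_hom sW sU "\<beta> x" for x by (rule \<beta>2)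
  interpret \<kappa>: module_hom sU sW "\<kappa> i" for i by (rule \<kappa>)
  let ?H = "vquot sW ZW BW"
  let ?P = "{p :: 'v \<times> 'w set \<Rightarrow>\<^sub>0 'k. Poly_Mapping.keys p \<subseteq> ZV \<times> (\<lambda>w. w +o BW) ` ZW}"
  define R where "R = tensor_rels (vsub sV ZV) ?H"
  have R: "free.subspace R"
    unfolding R_def tensor_rels_def by (rule free.subspace_span)
  have P: "free.subspace ?P"
  proof (rule free.subspaceI)
    show "p + q \<in> ?P" if "p \<in> ?P" "q \<in> ?P" for p q
      using that keys_add[of p q] by blast
    show "free_scale c p \<in> ?P" if "p \<in> ?P" for c p
      using that keys_free_scale[of c p] by blast
  qed simp

  \<comment> \<open>The second factor consists of cosets, but \<open>\<beta>\<close> is defined on representatives. A different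
  choice of \<open>rep\<close> changes \<open>L\<close> by elements of \<open>BU\<close> only, by \<open>\<beta>_B\<close>.\<close>
  define rep where "rep Y = (SOME w. w \<in> ZW \<and> Y = w +o BW)" for Y
  have rep: "rep (w +o BW) \<in> ZW" "rep (w +o BW) +o BW = w +o BW" if "w \<in> ZW" for w
    using someI_ex[of "\<lambda>w'. w' \<in> ZW \<and> w +o BW = w' +o BW"] that unfolding rep_def by auto
  have rep': "rep (w +o BW) - w \<in> BW" if "w \<in> ZW" for w
    using rep[OF that] by (simp add: W.coset_eq_iff[OF BW])
  define L where "L = linear_extension sU (\<lambda>(x, Y). \<beta> x (rep Y))"
  interpret L: module_hom free_scale sU L
    unfolding L_def by (rule U.module_hom_linear_extension)
  have L_single: "L (Poly_Mapping.single (x, Y) c) = sU c (\<beta> x (rep Y))" for x Y c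
    by (simp add: L_def)
  have L_single_coset: "L (Poly_Mapping.single (x, w +o BW) 1) - \<beta> x w \<in> BU"
    if "x \<in> ZV" "w \<in> ZW" for x w
    using \<beta>_B[OF that(1) rep'[OF that(2)]] by (simp add: L_single \<beta>2.diff)

  have rel_add1: "Poly_Mapping.single (x + x', w +o BW) 1 - Poly_Mapping.single (x, w +o BW) 1
      - Poly_Mapping.single (x', w +o BW) 1 \<in> R" if "x \<in> ZV" "x' \<in> ZV" "w \<in> ZW" for x x' w
    using tensor_rels_generators(1)[of x "vsub sV ZV" "w +o BW" ?H x'] that
    by (simp add: R_def vsub_def vquot_def)
  have rel_add2: "Poly_Mapping.single (x, (w + w') +o BW) 1 - Poly_Mapping.single (x, w +o BW) 1
      - Poly_Mapping.single (x, w' +o BW) 1 \<in> R" if "x \<in> ZV" "w \<in> ZW" "w' \<in> ZW" for x w w'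
    using tensor_rels_generators(2)[of x "vsub sV ZV" "w +o BW" ?H "w' +o BW"] that
    by (simp add: R_def vsub_def vquot_def W.coset_add[OF BW])
  have rel_scale1: "Poly_Mapping.single (sV c x, w +o BW) 1
      - Poly_Mapping.single (x, w +o BW) c \<in> R" if "x \<in> ZV" "w \<in> ZW" for x c w
    using tensor_rels_generators(3)[of x "vsub sV ZV" "w +o BW" ?H c] that
    by (simp add: R_def vsub_def vquot_def)
  have rel_scale2: "Poly_Mapping.single (x, sW c w +o BW) 1
      - Poly_Mapping.single (x, w +o BW) c \<in> R" if "x \<in> ZV" "w \<in> ZW" for x c w
    using tensor_rels_generators(4)[of x "vsub sV ZV" "w +o BW" ?H c] that
    by (simp add: R_def vsub_def vquot_def W.coset_scale[OF BW])

  have L_R: "L ` R \<subseteq> BU"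
  proof -
    have BW_add: "rep ((w + w') +o BW) - rep (w +o BW) - rep (w' +o BW) \<in> BW"
      if "w \<in> ZW" "w' \<in> ZW" for w w'
      using W.subspace_diff[OF BW W.subspace_diff[OF BW rep'[OF W.subspace_add[OF ZW that]] rep'[OF that(1)]]
          rep'[OF that(2)]]
      by (simp add: algebra_simps)
    have BW_scale: "rep (sW c w +o BW) - sW c (rep (w +o BW)) \<in> BW" if "w \<in> ZW" for c w
      using W.subspace_diff[OF BW rep'[OF W.subspace_scale[OF ZW that, of c]] W.subspace_scale[OF BW rep'[OF that], of c]]
      by (simp add: algebra_simps)
    have "R \<subseteq> L -` BU"
      unfolding R_def tensor_rels_def
    proof (rule free.span_minimal)
      show "free.subspace (L -` BU)"
        by (rule L.subspace_vimage[OF BU])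
    qed (auto simp: vsub_def vquot_def L.diff L_single \<beta>1.add \<beta>1.scale \<beta>2.diff[symmetric]
        \<beta>2.scale[symmetric] W.coset_add[OF BW] W.coset_scale[OF BW] U.subspace_0[OF BU]
        intro!: \<beta>_B BW_add BW_scale)
    then show ?thesis
      by auto
  qed

  have L_P: "L p \<in> ZU" if "p \<in> ?P" for p
    using that unfolding L_def linear_extension_def
    by (intro U.subspace_sum[OF ZU] U.subspace_scale[OF ZU]) (auto intro!: \<beta>_Z rep)

  have image: "\<exists>p \<in> ?P. \<eta> - L p \<in> BU" if \<eta>: "\<eta> \<in> ZU" for \<eta>
  proof -
    let ?p = "\<Sum>i\<in>I. Poly_Mapping.single (b i, \<kappa> i \<eta> +o BW) 1"
    have "?p \<in> ?P"
      by (rule free.subspace_sum[OF P]) (use \<kappa>_Z \<eta> b in auto)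
    moreover have "L ?p - (\<Sum>i\<in>I. \<beta> (b i) (\<kappa> i \<eta>)) \<in> BU"
      unfolding L.sum
      by (rule sum_congruent_mod_subspace[OF U.module_axioms BU]) (intro L_single_coset b \<kappa>_Z \<eta>)
    then have "\<eta> - L ?p \<in> BU"
      using U.subspace_diff[OF BU \<beta>\<kappa>[OF \<eta>]] by (fastforce simp: algebra_simps)
    ultimately show ?thesis
      by blast
  qed

  \<comment> \<open>The composite \<open>x \<otimes> w \<mapsto> \<Sum>\<^sub>i b i \<otimes> \<kappa> i (\<beta> x w)\<close>, computed in the free space modulo
  the bilinearity relations.\<close>
  have inverse: "(\<Sum>i\<in>I. Poly_Mapping.single (b i, \<kappa> i (L p) +o BW) 1) - p \<in> R" if p: "p \<in> ?P" for p
  proof -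
    let ?x = fst and ?w = "\<lambda>z. rep (snd z)"
    have keys: "?x z \<in> ZV" "?w z \<in> ZW" "?w z +o BW = snd z" if "z \<in> Poly_Mapping.keys p" for z
      using that p by (auto simp: rep)
    have \<kappa>L: "\<kappa> i (L p) = (\<Sum>z\<in>Poly_Mapping.keys p. sW (Poly_Mapping.lookup p z * e i (?x z)) (?w z))" for i
      unfolding L_def linear_extension_def
      by (simp add: \<kappa>.sum \<kappa>.scale \<kappa>\<beta> case_prod_beta)
    have "(\<Sum>i\<in>I. Poly_Mapping.single (b i, \<kappa> i (L p) +o BW) 1)
        - (\<Sum>i\<in>I. \<Sum>z\<in>Poly_Mapping.keys p. free_scale (Poly_Mapping.lookup p z * e i (?x z)) (Poly_Mapping.single (b i, ?w z +o BW) 1)) \<in> R"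
      unfolding \<kappa>L
      by (rule sum_congruent_mod_subspace[OF free.module_axioms R],
          rule linear_mod_subspace_sum[where g = "\<lambda>w. Poly_Mapping.single (b i, w +o BW) 1" for i, OF W free.vector_space_axioms ZW R])
        (use rel_add2 rel_scale2 b keys in auto)
    moreover have "(\<Sum>z\<in>Poly_Mapping.keys p. free_scale (Poly_Mapping.lookup p z) (Poly_Mapping.single z 1))
        - (\<Sum>z\<in>Poly_Mapping.keys p. free_scale (Poly_Mapping.lookup p z)
             (\<Sum>i\<in>I. free_scale (e i (?x z)) (Poly_Mapping.single (b i, ?w z +o BW) 1))) \<in> R"
    proof (rule sum_congruent_mod_subspace[OF free.module_axioms R])
      fix z assume z: "z \<in> Poly_Mapping.keys p"
      have "Poly_Mapping.single (\<Sum>i\<in>I. sV (e i (?x z)) (b i), ?w z +o BW) 1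
          - (\<Sum>i\<in>I. free_scale (e i (?x z)) (Poly_Mapping.single (b i, ?w z +o BW) 1)) \<in> R"
        by (rule linear_mod_subspace_sum[where g = "\<lambda>x. Poly_Mapping.single (x, ?w z +o BW) 1", OF V free.vector_space_axioms ZV R])
          (use rel_add1 rel_scale1 I b keys(1,2)[OF z] in auto)
      then have "Poly_Mapping.single z 1
          - (\<Sum>i\<in>I. free_scale (e i (?x z)) (Poly_Mapping.single (b i, ?w z +o BW) 1)) \<in> R"
        using frame[OF keys(1)[OF z]] keys(3)[OF z] by simp
      then show "free_scale (Poly_Mapping.lookup p z) (Poly_Mapping.single z 1) - free_scale (Poly_Mapping.lookup p z)
             (\<Sum>i\<in>I. free_scale (e i (?x z)) (Poly_Mapping.single (b i, ?w z +o BW) 1)) \<in> R"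
        unfolding free.scale_right_diff_distrib[symmetric] by (rule free.subspace_scale[OF R])
    qed
    moreover have "(\<Sum>z\<in>Poly_Mapping.keys p. free_scale (Poly_Mapping.lookup p z)
             (\<Sum>i\<in>I. free_scale (e i (?x z)) (Poly_Mapping.single (b i, ?w z +o BW) 1)))
        = (\<Sum>i\<in>I. \<Sum>z\<in>Poly_Mapping.keys p. free_scale (Poly_Mapping.lookup p z * e i (?x z)) (Poly_Mapping.single (b i, ?w z +o BW) 1))"
      by (subst sum.swap) (simp add: free.scale_sum_right)
    moreover have "(\<Sum>z\<in>Poly_Mapping.keys p. free_scale (Poly_Mapping.lookup p z) (Poly_Mapping.single z 1)) = p"
      by (simp add: poly_mapping_eq_sum_single[of p, symmetric])
    ultimately show ?thesis
      using free.subspace_diff[OF R] by fastforce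
  qed

  have kernel: "p \<in> R" if p: "p \<in> ?P" and Lp: "L p \<in> BU" for p
  proof -
    have "Poly_Mapping.single (b i, \<kappa> i (L p) +o BW) 1 \<in> R" if "i \<in> I" for i
    proof -
      have "\<kappa> i (L p) +o BW = sW 0 0 +o BW"
        using \<kappa>_B[OF that Lp] by (subst W.coset_eq_iff[OF BW]) simp
      then show ?thesis
        using rel_scale2[OF b[OF that] W.subspace_0[OF ZW], of 0] by simp
    qed
    then have "(\<Sum>i\<in>I. Poly_Mapping.single (b i, \<kappa> i (L p) +o BW) 1) \<in> R"
      by (rule free.subspace_sum[OF R])
    from free.subspace_diff[OF R this inverse[OF p]] show ?thesis
      by simp
  qed

  have "\<exists>\<Phi>. viso (vquot free_scale ?P R) (vquot sU ZU BU) \<Phi> \<and> (\<forall>p. \<Phi> (p +o R) = L p +o BU)"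
    by (rule L.viso_vquot[OF R BU _ L_R kernel P image]) (use L_P in auto)
  then obtain \<Phi> where \<Phi>: "viso (vquot free_scale ?P R) (vquot sU ZU BU) \<Phi>" "\<And>p. \<Phi> (p +o R) = L p +o BU"
    by blast
  have "T = vquot free_scale ?P R"
    by (simp add: T_def tensor_def R_def vsub_def vquot_def)
  moreover have "\<Phi> (pure_tensor (vsub sV ZV) ?H x (w +o BW)) = \<beta> x w +o BU" if "x \<in> ZV" "w \<in> ZW" for x w
    using L_single_coset[OF that] unfolding pure_tensor_def R_def[symmetric] \<Phi>(2)
    by (simp add: U.coset_eq_iff[OF BU])
  ultimately show ?thesis
    using \<Phi>(1) by auto
qed

section \<open>Alternating multilinear maps\<close>

lemma vector_space_fscale:
  assumes "vector_space s"
  shows "vector_space (fscale s :: 'k::field \<Rightarrow> ('a \<Rightarrow> 'v::ab_group_add) \<Rightarrow> 'a \<Rightarrow> 'v)"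
proof -
  interpret vector_space s by fact
  show ?thesis
    by unfold_locales (auto simp: fscale_def plus_fun_def scale_right_distrib scale_left_distrib)
qed

lemma fscale_apply: "fscale s c f x = s c (f x)"
  by (simp add: fscale_def)

lemma sum_apply: "sum f A x = (\<Sum>a\<in>A. f a x)"
  by (induction A rule: infinite_finite_induct) auto

lemma mscale_component [simp]: "mscale c A $ i $ j = c * A $ i $ j"
  by (simp add: mscale_def)

interpretation mat: vector_space "mscale :: 'k::field \<Rightarrow> 'k ^ 'n ^ 'm \<Rightarrow> 'k ^ 'n ^ 'm"
  by unfold_locales (simp_all add: vec_eq_iff algebra_simps)

lemma module_homI:
  assumes "vector_space s1" "vector_space s2"
    and "\<And>x y. f (x + y) = f x + f y" "\<And>c x. f (s1 c x) = s2 c (f x)"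
  shows "module_hom s1 s2 f"
  using assms by (simp add: module_hom_iff module_iff_vector_space)

text \<open>Linearity in each slot can be demanded on lists of every length: on lists of the wrong length the
map vanishes, and zero is linear. Proofs of multilinearity then need no arithmetic with lengths.\<close>

lemma multilinear_iff:
  fixes \<psi> :: "('k::field ^ 'n ^ 'n) list \<Rightarrow> 'v::ab_group_add"
  assumes "vector_space s"
  shows "multilinear s k \<psi> \<longleftrightarrow>
    (\<forall>as. length as \<noteq> k \<longrightarrow> \<psi> as = 0) \<and>
    (\<forall>as i. i < length as \<longrightarrow> module_hom mscale s (\<lambda>x. \<psi> (as[i := x])))"
proof -
  interpret vector_space s by fact
  have "module_hom mscale s (\<lambda>x. \<psi> (as[i := x]))"
    if "\<And>as. length as \<noteq> k \<Longrightarrow> \<psi> as = 0" "length as \<noteq> k" for as i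
    by (rule module_homI) (auto simp: mat.vector_space_axioms vector_space_axioms that)
  then show ?thesis
    unfolding multilinear_def module_hom_iff_linear[symmetric] by (metis (no_types, lifting))
qed

definition alt_maps :: "('k::field \<Rightarrow> 'v::ab_group_add \<Rightarrow> 'v) \<Rightarrow> nat \<Rightarrow> (('k ^ 'n ^ 'n) list \<Rightarrow> 'v) set" where
  "alt_maps s k = {G. multilinear s k G \<and> alternating_from 0 G}"

context
  fixes s :: "'k::field \<Rightarrow> 'v::ab_group_add \<Rightarrow> 'v"
  assumes s: "vector_space s"
begin

interpretation vector_space s by (rule s)

lemma alt_mapsI:
  assumes "\<And>as. length as \<noteq> k \<Longrightarrow> G as = 0"
    and "\<And>as i. i < length as \<Longrightarrow> module_hom mscale s (\<lambda>x. G (as[i := x]))"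
    and "\<And>as i j. i < j \<Longrightarrow> j < length as \<Longrightarrow> as ! i = as ! j \<Longrightarrow> G as = 0"
  shows "G \<in> alt_maps s k"
  using assms by (auto simp: alt_maps_def multilinear_iff[OF s] alternating_from_def)

lemma alt_mapsD:
  assumes "G \<in> alt_maps s k"
  shows "length as \<noteq> k \<Longrightarrow> G as = 0"
    and "i < length as \<Longrightarrow> module_hom mscale s (\<lambda>x. G (as[i := x]))"
    and "i < j \<Longrightarrow> j < length as \<Longrightarrow> as ! i = as ! j \<Longrightarrow> G as = 0"
  using assms unfolding alt_maps_def multilinear_iff[OF s] alternating_from_def by blast+

lemma alt_maps_add:
  assumes "G \<in> alt_maps s k" "i < length as"
  shows "G (as[i := x + y]) = G (as[i := x]) + G (as[i := y])"
  using alt_mapsD(2)[OF assms] by (simp add: module_hom_iff)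

lemma alt_maps_scale:
  assumes "G \<in> alt_maps s k" "i < length as"
  shows "G (as[i := mscale c x]) = s c (G (as[i := x]))"
  using alt_mapsD(2)[OF assms] by (simp add: module_hom_iff)

lemma subspace_alt_maps: "module.subspace (fscale s) (alt_maps s k)"
proof -
  interpret F: vector_space "fscale s" by (rule vector_space_fscale[OF s])
  show ?thesis
    by (rule F.subspaceI; rule alt_mapsI)
      (auto simp: fscale_apply alt_mapsD module_hom_iff mat.module_axioms module_axioms
        alt_maps_add alt_maps_scale scale_right_distrib mult.commute)
qed

lemma alt_maps_postcompose:
  assumes f: "module_hom s t f" and G: "G \<in> alt_maps s k" and t: "vector_space t"
  shows "(\<lambda>bs. f (G bs)) \<in> alt_maps t k"
proof -
  interpret f: module_hom s t f by fact
  have "multilinear t k (\<lambda>bs. f (G bs))"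
    using module_hom_compose[OF alt_mapsD(2)[OF G] f]
    by (auto simp: multilinear_iff[OF t] alt_mapsD[OF G] o_def)
  then show ?thesis
    using alt_mapsD(3)[OF G] by (simp add: alt_maps_def alternating_from_def) (metis f.zero)
qed

lemma alt_maps_Cons:
  assumes G: "G \<in> alt_maps s (Suc k)"
  shows "(\<lambda>bs. G (x # bs)) \<in> alt_maps s k"
proof (rule alt_mapsI)
  show "module_hom mscale s (\<lambda>y. G (x # as[i := y]))" if "i < length as" for as i
    using alt_mapsD(2)[OF G, of "Suc i" "x # as"] that by simp
  show "G (x # as) = 0" if "i < j" "j < length as" "as ! i = as ! j" for as i j
    using alt_mapsD(3)[OF G, of "Suc i" "Suc j" "x # as"] that by simp
qed (simp add: alt_mapsD(1)[OF G])

lemma alt_maps_swap: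
  assumes G: "G \<in> alt_maps s k" and ij: "i < j" "j < length as"
  shows "G (as[i := x, j := y]) = - G (as[i := y, j := x])"
proof -
  define F where "F a b = G (as[i := a, j := b])" for a b
  have 1: "F a (b + c) = F a b + F a c" for a b c
    using alt_maps_add[OF G, of j "as[i := a]"] ij by (simp add: F_def)
  have 2: "F (a + b) c = F a c + F b c" for a b c
    using alt_maps_add[OF G, of i "as[j := c]"] ij by (simp add: F_def list_update_swap)
  have 3: "F a a = 0" for a
    unfolding F_def using ij by (intro alt_mapsD(3)[OF G, of i j]) auto
  have "F (x + y) (x + y) = 0"
    by (rule 3)
  then have "F x y + F y x = 0"
    unfolding 1 2 by (simp add: 3 add.commute)
  then show ?thesis
    unfolding F_def by (simp add: eq_neg_iff_add_eq_0)
qed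

text \<open>Moving an argument from position \<open>i\<close> to the front takes \<open>i\<close> adjacent transpositions.\<close>

lemma alt_maps_move_to_front:
  assumes G: "G \<in> alt_maps s k" and "i < length bs"
  shows "G (x # del i bs) = s ((-1) ^ i) (G (bs[i := x]))"
  using assms(2)
proof (induction i arbitrary: bs)
  case 0
  then show ?case
    by (cases bs) (auto simp: del_def)
next
  case (Suc i)
  let ?bs = "bs[Suc i := bs ! i]"
  have "G (x # del (Suc i) bs) = G (x # del i ?bs)"
    using Suc.prems by (simp add: del_def upd_conv_take_nth_drop take_Suc_conv_app_nth)
  also have "\<dots> = s ((-1) ^ i) (G (?bs[i := x]))"
    using Suc.prems by (intro Suc.IH) simp
  also have "?bs[i := x] = bs[i := x, Suc i := bs ! i]"
    by (simp add: list_update_swap)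
  also have "G \<dots> = - G (bs[i := bs ! i, Suc i := x])"
    using Suc.prems by (intro alt_maps_swap[OF G]) auto
  finally show ?case
    by simp
qed

end

section \<open>The differential with coefficients\<close>

lemma del_0 [simp]: "del 0 (x # as) = as"
  and del_Suc [simp]: "del (Suc i) (x # as) = x # del i as"
  by (simp_all add: del_def)

lemma length_del [simp]: "i < length as \<Longrightarrow> length (del i as) = length as - 1"
  by (simp add: del_def)

text \<open>The Chevalley--Eilenberg differential with coefficients in a right module, where \<open>act a v\<close> stands
for \<open>v \<cdot> a\<close>. The bracket replaces the argument at position \<open>j\<close> rather than moving to the front,
which makes the formulas below independent of alternation.\<close>

definition ce_d ::
  "('k::field \<Rightarrow> 'v::ab_group_add \<Rightarrow> 'v) \<Rightarrow> ('k ^ 'n ^ 'n \<Rightarrow> 'v \<Rightarrow> 'v) \<Rightarrow>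
   (('k ^ 'n ^ 'n) list \<Rightarrow> 'v) \<Rightarrow> ('k ^ 'n ^ 'n) list \<Rightarrow> 'v" where
  "ce_d s act G bs =
     (\<Sum>i<length bs. s ((-1) ^ i) (act (bs ! i) (G (del i bs)))) +
     (\<Sum>i<length bs. \<Sum>j = Suc i..<length bs. s ((-1) ^ i) (G (del i (bs[j := br (bs ! i) (bs ! j)]))))"

lemma lie_d_eq_ce_d: "lie_d \<psi> bs = ce_d (*) (\<lambda>_ _. 0) \<psi> bs"
  by (simp add: lie_d_def ce_d_def lessThan_atLeast0)

text \<open>An equivariant map of coefficients is a chain map. Equivariance is only required on the values of
\<open>G\<close>, as the maps of interest are equivariant on linear endomorphisms but not on all functions.\<close>

lemma ce_d_natural:
  assumes "module_hom s t f" and "\<And>a bs. f (act a (G bs)) = act' a (f (G bs))"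
  shows "f (ce_d s act G bs) = ce_d t act' (\<lambda>bs. f (G bs)) bs"
proof -
  interpret module_hom s t f by fact
  show ?thesis
    by (simp add: ce_d_def add sum scale assms(2))
qed

text \<open>Cartan's formula \<open>\<iota>\<^sub>x d + d \<iota>\<^sub>x = L\<^sub>x\<close>: the summands of the differential that single out the first
argument \<open>x\<close> form the Lie derivative along \<open>x\<close>, and in all the others the index is shifted by one,
so that they are those of the contraction by \<open>x\<close> with the opposite sign.\<close>

lemma (in vector_space) cartan_formula:
  "ce_d scale act G (x # bs) =
     act x (G bs) + (\<Sum>j<length bs. G (bs[j := br x (bs ! j)])) - ce_d scale act (\<lambda>cs. G (x # cs)) bs"
  unfolding ce_d_def length_Cons sum.lessThan_Suc_shift sum.atLeast_Suc_lessThan_Suc_shift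
  by (simp add: sum_negf lessThan_atLeast0)

lemma br_mat_1 [simp]: "br (mat 1) b = 0"
  by (simp add: br_def)

text \<open>As the identity matrix is central, the Lie derivative along it is just its action on values. So
contraction by the identity is a contracting homotopy on every part of the module on which the
identity acts as a nonzero scalar.\<close>

lemma central_homotopy:
  assumes s: "vector_space s" and G: "G \<in> alt_maps s k"
    and cocycle: "ce_d s act G (mat 1 # bs) = 0"
  shows "ce_d s act (\<lambda>cs. G (mat 1 # cs)) bs = act (mat 1) (G bs)"
proof -
  interpret vector_space s by fact
  have "G (bs[j := br (mat 1) (bs ! j)]) = 0" if "j < length bs" for j
    using alt_maps_scale[OF s G that, of 0 0] by simp
  then show ?thesis
    using cocycle by (simp add: cartan_formula)
qed

lemma matrix_mult_bilinear:
  "module_hom mscale mscale (\<lambda>A :: 'k::field ^ 'n ^ 'n. A ** B)"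
  "module_hom mscale mscale (\<lambda>B :: 'k::field ^ 'n ^ 'n. A ** B)"
  by (auto intro!: module_homI mat.vector_space_axioms
      simp: vec_eq_iff matrix_matrix_mult_def sum.distrib sum_distrib_left algebra_simps)

interpretation mult_left: module_hom mscale mscale "\<lambda>A :: 'k::field ^ 'n ^ 'n. A ** B" for B
  by (rule matrix_mult_bilinear)

interpretation mult_right: module_hom mscale mscale "\<lambda>B :: 'k::field ^ 'n ^ 'n. A ** B" for A
  by (rule matrix_mult_bilinear)

section \<open>The Casimir element of gl\<close>

definition munit :: "'n \<Rightarrow> 'n \<Rightarrow> 'k::field ^ 'n ^ 'n" where
  "munit p q = (\<chi> i j. if i = p \<and> j = q then 1 else 0)"

lemma munit_mult: "munit p q ** b = (\<Sum>r\<in>UNIV. mscale (b $ q $ r) (munit p r))"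
  by (simp add: vec_eq_iff munit_def matrix_matrix_mult_def if_distrib[of "\<lambda>x. x * _"]
      if_distrib[of "\<lambda>x. _ * x"] if_conn sum.If_cases cong: if_cong)

lemma mult_munit: "b ** munit q p = (\<Sum>r\<in>UNIV. mscale (b $ r $ q) (munit r p))"
  by (simp add: vec_eq_iff munit_def matrix_matrix_mult_def if_distrib[of "\<lambda>x. x * _"]
      if_distrib[of "\<lambda>x. _ * x"] if_conn sum.If_cases cong: if_cong)

text \<open>The families \<open>munit p q\<close> and \<open>munit q p\<close> are dual bases for the trace form
\<open>(x, y) \<mapsto> trace (x ** y)\<close>. Since this form is associative, a factor can be moved from one leg of
\<open>\<Sum> munit p q \<otimes> munit q p\<close> to the other.\<close>

lemma casimir_move:
  assumes B1: "\<And>y. module_hom mscale s (\<lambda>x. B x y)" and B2: "\<And>x. module_hom mscale s (B x)"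
  shows "(\<Sum>p\<in>UNIV. \<Sum>q\<in>UNIV. B (munit p q ** b) (munit q p)) =
      (\<Sum>p\<in>UNIV. \<Sum>q\<in>UNIV. B (munit p q) (b ** munit q p))" (is ?right)
    and "(\<Sum>p\<in>UNIV. \<Sum>q\<in>UNIV. B (b ** munit p q) (munit q p)) =
      (\<Sum>p\<in>UNIV. \<Sum>q\<in>UNIV. B (munit p q) (munit q p ** b))" (is ?left)
proof -
  interpret B1: module_hom mscale s "\<lambda>x. B x y" for y by (rule B1)
  interpret B2: module_hom mscale s "B x" for x by (rule B2)
  show ?right
    by (simp add: munit_mult mult_munit B1.sum B2.sum B1.scale B2.scale) (subst (2) sum.swap, rule refl)
  have "(\<Sum>p\<in>UNIV. \<Sum>q\<in>UNIV. B (b ** munit p q) (munit q p)) =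
      (\<Sum>q\<in>UNIV. \<Sum>p\<in>UNIV. \<Sum>r\<in>UNIV. s (b $ r $ p) (B (munit r q) (munit q p)))"
    by (subst sum.swap) (simp add: mult_munit B1.sum B1.scale)
  also have "\<dots> = (\<Sum>q\<in>UNIV. \<Sum>r\<in>UNIV. \<Sum>p\<in>UNIV. s (b $ r $ p) (B (munit r q) (munit q p)))"
    by (intro sum.cong refl sum.swap)
  also have "\<dots> = (\<Sum>p\<in>UNIV. \<Sum>q\<in>UNIV. B (munit p q) (munit q p ** b))"
    by (subst sum.swap) (simp add: munit_mult B2.sum B2.scale)
  finally show ?left .
qed

lemma casimir_invariant:
  assumes B1: "\<And>y. module_hom mscale s (\<lambda>x. B x y)" and B2: "\<And>x. module_hom mscale s (B x)"
  shows "(\<Sum>p\<in>UNIV. \<Sum>q\<in>UNIV. B (br (munit p q) b) (munit q p) + B (munit p q) (br (munit q p) b)) = 0"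
proof -
  interpret B1: module_hom mscale s "\<lambda>x. B x y" for y by (rule B1)
  interpret B2: module_hom mscale s "B x" for x by (rule B2)
  show ?thesis
    using casimir_move[of s B b, OF B1 B2]
    by (simp add: br_def B1.diff B2.diff sum.distrib sum_subtractf)
qed

text \<open>The argument behind Whitehead's lemma: on cocycles, \<open>G \<mapsto> \<Sum> act (munit p q) (\<iota> (munit q p) G)\<close> is
a homotopy from the Casimir operator to zero. By Cartan's formula the differential of the summand
for \<open>y = munit p q\<close> and \<open>x = munit q p\<close> is \<open>act y (act x G)\<close> plus one term for each argument
\<open>bs ! i\<close>, namely \<open>act (br y (bs ! i)) G(\<dots>, x, \<dots>) + act y G(\<dots>, br x (bs ! i), \<dots>)\<close>. For a fixed
argument these terms sum to zero, because the Casimir element is invariant.\<close>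

lemma casimir_homotopy:
  fixes s :: "'k::field \<Rightarrow> 'v::ab_group_add \<Rightarrow> 'v" and G :: "('k ^ 'n::finite ^ 'n) list \<Rightarrow> 'v"
  assumes s: "vector_space s" and G: "G \<in> alt_maps s k"
    and act1: "\<And>a. module_hom s s (act a)" and act2: "\<And>bs. module_hom mscale s (\<lambda>a. act a (G bs))"
    and act_br: "\<And>a b bs. act b (act a (G bs)) - act a (act b (G bs)) = act (br a b) (G bs)"
    and cocycle: "\<And>x. ce_d s act G (x # bs) = 0"
  shows "ce_d s act (\<lambda>cs. \<Sum>p\<in>UNIV. \<Sum>q\<in>UNIV. act (munit p q) (G (munit q p # cs))) bs =
    (\<Sum>p\<in>UNIV. \<Sum>q\<in>UNIV. act (munit p q) (act (munit q p) (G bs)))"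
proof -
  interpret vector_space s by fact
  interpret act1: module_hom s s "act a" for a by (rule act1)
  interpret act2: module_hom mscale s "\<lambda>a. act a (G cs)" for cs by (rule act2)
  have sum: "ce_d s act (\<lambda>cs. \<Sum>p\<in>P. F p cs) bs = (\<Sum>p\<in>P. ce_d s act (F p) bs)" if "finite P"
    for P :: "'z set" and F
    using that by induction (simp_all add: ce_d_def act1.zero act1.add scale_right_distrib sum.distrib algebra_simps)
  have summand: "ce_d s act (\<lambda>cs. act y (G (x # cs))) bs = act y (act x (G bs)) +
      (\<Sum>i<length bs. act (br y (bs ! i)) (G (bs[i := x])) + act y (G (bs[i := br x (bs ! i)])))" for x y
  proof -
    have *: "s ((-1) ^ i) (act (bs ! i) (act y (G (x # del i bs)))) =
        s ((-1) ^ i) (act y (act (bs ! i) (G (x # del i bs)))) + act (br y (bs ! i)) (G (bs[i := x]))"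
      if "i < length bs" for i
    proof -
      have "act (bs ! i) (act y (G (x # del i bs))) = act y (act (bs ! i) (G (x # del i bs)))
          + s ((-1) ^ i) (act (br y (bs ! i)) (G (bs[i := x])))"
        using act_br[of "bs ! i" y "x # del i bs"] 
        by (simp add: alt_maps_move_to_front[OF s G that] act1.scale algebra_simps)
      then show ?thesis
        by (simp add: scale_right_distrib flip: power_add mult_2)
    qed
    have "ce_d s act (\<lambda>cs. act y (G (x # cs))) bs =
        act y (ce_d s act (\<lambda>cs. G (x # cs)) bs) + (\<Sum>i<length bs. act (br y (bs ! i)) (G (bs[i := x])))"
      by (simp add: ce_d_def * sum.distrib act1.add act1.sum act1.scale)
    also have "ce_d s act (\<lambda>cs. G (x # cs)) bs = act x (G bs) + (\<Sum>j<length bs. G (bs[j := br x (bs ! j)]))"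
      using cocycle[of x] unfolding cartan_formula right_minus_eq by (rule sym)
    finally show ?thesis
      by (simp add: act1.add act1.sum sum.distrib algebra_simps)
  qed
  have rotate: "(\<Sum>p\<in>P. \<Sum>q\<in>Q. \<Sum>i\<in>I. Y i p q) = (\<Sum>i\<in>I. \<Sum>p\<in>P. \<Sum>q\<in>Q. Y i p q)"
    for P Q :: "'n set" and I :: "nat set" and Y :: "nat \<Rightarrow> 'n \<Rightarrow> 'n \<Rightarrow> 'v"
  proof -
    have "(\<Sum>p\<in>P. \<Sum>q\<in>Q. \<Sum>i\<in>I. Y i p q) = (\<Sum>p\<in>P. \<Sum>i\<in>I. \<Sum>q\<in>Q. Y i p q)"
      by (rule sum.cong[OF refl]) (rule sum.swap)
    then show ?thesis
      by (simp only: sum.swap[of _ I P])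
  qed
  have invariant: "(\<Sum>p\<in>UNIV. \<Sum>q\<in>UNIV. act (br (munit p q) (bs ! i)) (G (bs[i := munit q p])) +
      act (munit p q) (G (bs[i := br (munit q p) (bs ! i)]))) = 0" if "i < length bs" for i
  proof (rule casimir_invariant)
    show "module_hom mscale s (\<lambda>x. act x (G (bs[i := y])))" for y
      by (rule act2)
    show "module_hom mscale s (\<lambda>y. act x (G (bs[i := y])))" for x
      using module_hom_compose[OF alt_mapsD(2)[OF s G that] act1] by (simp add: o_def)
  qed
  have "ce_d s act (\<lambda>cs. \<Sum>p\<in>UNIV. \<Sum>q\<in>UNIV. act (munit p q) (G (munit q p # cs))) bs =
      (\<Sum>p\<in>UNIV. \<Sum>q\<in>UNIV. act (munit p q) (act (munit q p) (G bs))) +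
      (\<Sum>i<length bs. \<Sum>p\<in>UNIV. \<Sum>q\<in>UNIV. act (br (munit p q) (bs ! i)) (G (bs[i := munit q p])) +
        act (munit p q) (G (bs[i := br (munit q p) (bs ! i)])))"
    unfolding sum[OF finite] summand by (simp only: sum.distrib rotate)
  then show ?thesis
    by (simp add: invariant)
qed

section \<open>The module of linear endomorphisms\<close>

text \<open>The action \<open>f \<cdot> a\<close> of the Lie algebra on endomorphisms for which the right-symmetric complex is a
Chevalley--Eilenberg complex. Its invariants are the derivations. The summand \<open>u ** f a\<close> makes it
differ from the usual action on endomorphisms of the right regular module.\<close>

definition lact :: "'k::field ^ 'n ^ 'n \<Rightarrow> ('k ^ 'n ^ 'n \<Rightarrow> 'k ^ 'n ^ 'n) \<Rightarrow> 'k ^ 'n ^ 'n \<Rightarrow> 'k ^ 'n ^ 'n" where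
  "lact a f u = u ** f a - f (u ** a) + f u ** a"

interpretation endo: vector_space "fscale mscale :: 'k::field \<Rightarrow> ('a \<Rightarrow> 'k ^ 'n ^ 'n) \<Rightarrow> 'a \<Rightarrow> 'k ^ 'n ^ 'n"
  by (rule vector_space_fscale[OF mat.vector_space_axioms])

interpretation lact: module_hom "fscale mscale" "fscale mscale" "lact a" for a :: "'k::field ^ 'n ^ 'n"
  by (rule module_homI) (auto simp: fun_eq_iff fscale_apply lact_def mat.scale_right_distrib
      mat.scale_right_diff_distrib mult_left.add mult_right.add mult_left.scale mult_right.scale
      endo.vector_space_axioms)

lemma lact_br:
  fixes f :: "'k::field ^ 'n ^ 'n \<Rightarrow> 'k ^ 'n ^ 'n"
  assumes "module_hom mscale mscale f"
  shows "lact b (lact a f) - lact a (lact b f) = lact (br a b) f"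
proof -
  interpret f: module_hom mscale mscale f by fact
  show ?thesis
    by (rule ext) (simp add: lact_def br_def f.diff mult_left.add mult_right.add mult_left.diff
        mult_right.diff matrix_mul_assoc)
qed

lemma module_hom_lact_left:
  fixes f :: "'k::field ^ 'n ^ 'n \<Rightarrow> 'k ^ 'n ^ 'n"
  assumes "module_hom mscale mscale f"
  shows "module_hom mscale (fscale mscale) (\<lambda>a. lact a f)"
proof -
  interpret f: module_hom mscale mscale f by fact
  show ?thesis
    by (rule module_homI) (auto simp: fun_eq_iff fscale_apply lact_def f.add f.scale
        mat.scale_right_distrib mat.scale_right_diff_distrib mult_left.add mult_right.add
        mult_left.scale mult_right.scale mat.vector_space_axioms endo.vector_space_axioms)
qed

lemma module_hom_lact:
  fixes f :: "'k::field ^ 'n ^ 'n \<Rightarrow> 'k ^ 'n ^ 'n"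
  assumes "module_hom mscale mscale f"
  shows "module_hom mscale mscale (lact a f)"
proof -
  interpret f: module_hom mscale mscale f by fact
  show ?thesis
    by (rule module_homI) (auto simp: fun_eq_iff fscale_apply lact_def f.add f.scale
        mat.scale_right_distrib mat.scale_right_diff_distrib mult_left.add mult_right.add
        mult_left.scale mult_right.scale mat.vector_space_axioms)
qed

text \<open>Up to the factor \<open>CARD('n)\<close>, this is the unique matrix \<open>c\<close> for which left multiplication by \<open>c\<close> is
the component of \<open>f\<close> that commutes with right multiplications; \<open>f = br X\<close> with traceless \<open>X\<close> is
sent to a multiple of \<open>X\<close>, and right multiplications are sent to scalar matrices.\<close>

definition contract :: "('k::field ^ 'n::finite ^ 'n \<Rightarrow> 'k ^ 'n ^ 'n) \<Rightarrow> 'k ^ 'n ^ 'n" where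
  "contract f = (\<Sum>p\<in>UNIV. \<Sum>q\<in>UNIV. f (munit p q) ** munit q p)"

lemma munit_mult_component: "(munit p q ** b) $ i $ j = (if i = p then b $ q $ j else 0)"
  by (simp add: munit_def matrix_matrix_mult_def if_distrib[of "\<lambda>x. x * _"] if_conn cong: if_cong)

lemma mult_munit_component: "(b ** munit q p) $ i $ j = (if j = p then b $ i $ q else 0)"
  by (simp add: munit_def matrix_matrix_mult_def if_distrib[of "\<lambda>x. _ * x"] if_conn cong: if_cong)

lemma sum_munit_diagonal: "(\<Sum>p\<in>UNIV. munit p p) = (mat 1 :: 'k::field ^ 'n::finite ^ 'n)"
proof -
  have "(\<Sum>p\<in>UNIV. if i = p \<and> j = p then 1 else 0 :: 'k) = (\<Sum>p\<in>UNIV. if p = i then if i = j then 1 else 0 else 0)"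
    for i j :: 'n
    by (rule sum.cong) auto
  then show ?thesis
    by (simp add: vec_eq_iff munit_def mat_def)
qed

lemma sum_munit_conj: "(\<Sum>p\<in>UNIV. \<Sum>q\<in>UNIV. munit p q ** X ** munit q p) =
    mscale (trace X) (mat 1 :: 'k::field ^ 'n::finite ^ 'n)"
proof -
  have "(munit p q ** X ** munit q p) $ i $ j = (if i = p \<and> j = p then X $ q $ q else 0)" for p q i j :: 'n
    by (auto simp: mult_munit_component munit_mult_component)
  then have "(\<Sum>q\<in>UNIV. munit p q ** X ** munit q p) = mscale (trace X) (munit p p)" for p :: 'n
    by (auto simp: vec_eq_iff trace_def munit_def[of p p] intro!: sum.neutral)
  then show ?thesis
    by (simp add: mat.scale_sum_right[symmetric] sum_munit_diagonal)
qed

lemma sum_munit_munit: "(\<Sum>p\<in>UNIV. \<Sum>q\<in>UNIV. munit p q ** munit q p) =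
    mscale (of_nat CARD('n)) (mat 1 :: 'k::field ^ 'n::finite ^ 'n)"
  using sum_munit_conj[of "mat 1 :: 'k ^ 'n ^ 'n"] by (simp add: trace_I)

lemma trace_mscale: "trace (mscale c A) = c * trace A"
  by (simp add: trace_def sum_distrib_left)

text \<open>Removing the trace turns \<open>contract\<close>, which is invariant only up to scalar matrices, into an
invariant map. The normalisation makes it a left inverse of \<open>X \<mapsto> br X\<close> on traceless matrices.\<close>

definition slpart :: "('k::field ^ 'n::finite ^ 'n \<Rightarrow> 'k ^ 'n ^ 'n) \<Rightarrow> 'k ^ 'n ^ 'n" where
  "slpart f = mscale (1 / of_nat CARD('n))
     (contract f - mscale (trace (contract f) / of_nat CARD('n)) (mat 1))"

interpretation contract: module_hom "fscale mscale" mscale "contract :: ('k::field ^ 'n::finite ^ 'n \<Rightarrow> _) \<Rightarrow> _"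
  by (rule module_homI) (auto simp: contract_def fscale_apply mult_left.add mult_left.scale sum.distrib
      mat.scale_sum_right mat.vector_space_axioms endo.vector_space_axioms)

interpretation slpart: module_hom "fscale mscale" mscale "slpart :: ('k::field ^ 'n::finite ^ 'n \<Rightarrow> _) \<Rightarrow> _"
  by (rule module_homI) (auto simp: slpart_def contract.add contract.scale trace_add trace_mscale
      mat.scale_right_diff_distrib mat.scale_right_distrib mat.scale_left_distrib
      add_divide_distrib mult.commute mat.vector_space_axioms endo.vector_space_axioms)

lemma slpart_eq_0:
  assumes "contract f = mscale c (mat 1 :: 'k::field_char_0 ^ 'n::finite ^ 'n)"
  shows "slpart f = 0"
  by (simp add: slpart_def assms trace_mscale trace_I)

text \<open>The two summands of \<open>lact\<close> that come from the right regular module cancel by invariance of the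
Casimir element. What remains is \<open>\<Sum> munit p q ** f a ** munit q p\<close>, which is a scalar matrix.\<close>

lemma contract_lact:
  fixes f :: "'k::field ^ 'n::finite ^ 'n \<Rightarrow> 'k ^ 'n ^ 'n"
  assumes "module_hom mscale mscale f"
  shows "contract (lact a f) = mscale (trace (f a)) (mat 1)"
proof -
  interpret f: module_hom mscale mscale f by fact
  have "(\<Sum>p\<in>UNIV. \<Sum>q\<in>UNIV. f (munit p q ** a) ** munit q p) =
      (\<Sum>p\<in>UNIV. \<Sum>q\<in>UNIV. f (munit p q) ** (a ** munit q p))"
    by (rule casimir_move[of mscale "\<lambda>x y. f x ** y"])
      (auto intro!: module_homI mat.vector_space_axioms simp: f.add f.scale mult_left.add mult_right.add
        mult_left.scale mult_right.scale)
  then show ?thesis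
    by (simp add: contract_def lact_def mult_left.add mult_left.diff sum.distrib sum_subtractf
        sum_munit_conj matrix_mul_assoc)
qed

lemma slpart_lact:
  fixes f :: "'k::field_char_0 ^ 'n::finite ^ 'n \<Rightarrow> 'k ^ 'n ^ 'n"
  assumes "module_hom mscale mscale f"
  shows "slpart (lact a f) = 0"
  by (rule slpart_eq_0[OF contract_lact[OF assms]])

lemma slpart_br:
  fixes X :: "'k::field_char_0 ^ 'n::finite ^ 'n"
  assumes "X \<in> sl"
  shows "slpart (br X) = X"
proof -
  have "contract (br X) = X ** (\<Sum>p\<in>UNIV. \<Sum>q\<in>UNIV. munit p q ** munit q p)
      - (\<Sum>p\<in>UNIV. \<Sum>q\<in>UNIV. munit p q ** X ** munit q p)"
    by (simp add: contract_def br_def mult_left.diff mult_right.sum sum_subtractf matrix_mul_assoc)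
  also have "\<dots> = mscale (of_nat CARD('n)) X"
    using assms by (simp add: sum_munit_munit sum_munit_conj sl_def mult_right.scale)
  finally show ?thesis
    using assms by (simp add: slpart_def trace_mscale sl_def)
qed

lemma slpart_in_sl: "slpart f \<in> (sl :: ('k::field_char_0 ^ 'n::finite ^ 'n) set)"
  by (simp add: sl_def slpart_def trace_mscale trace_sub trace_I)

text \<open>Let \<open>n = CARD('n)\<close> be invertible in the field. With the projection \<open>P f = br (slpart f)\<close> onto derivations and the action
\<open>T = lact (mat 1)\<close> of the identity, for which \<open>T f u = u ** f (mat 1)\<close>, this says that the Casimir
operator is \<open>2n (1 - P) - n T\<close>.\<close>

lemma casimir_lact:
  fixes f :: "'k::field ^ 'n::finite ^ 'n \<Rightarrow> 'k ^ 'n ^ 'n"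
  assumes "module_hom mscale mscale f"
  defines "K \<equiv> contract f" and "N \<equiv> of_nat CARD('n) :: 'k"
  shows "(\<Sum>p\<in>UNIV. \<Sum>q\<in>UNIV. lact (munit p q) (lact (munit q p) f)) u =
    mscale (2 * N) (f u) - mscale 2 (br K u) - mscale N (u ** f (mat 1))"
proof -
  interpret f: module_hom mscale mscale f by fact
  let ?S = "\<lambda>F. \<Sum>p\<in>UNIV. \<Sum>q\<in>UNIV. F (munit p q) (munit q p :: 'k ^ 'n ^ 'n) :: 'k ^ 'n ^ 'n"
  have swap: "?S (\<lambda>x y. F y x) = ?S F" for F
    by (rule sum.swap)
  have "?S (\<lambda>x y. lact x (lact y f) u) =
      ?S (\<lambda>x y. u ** (f x ** y) + u ** (f y ** x) - u ** f (x ** y) + f (u ** x ** y) 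
         - f (u ** x) ** y - f (u ** y) ** x + f u ** (y ** x))"
    by (simp add: lact_def mult_left.add mult_right.add mult_left.diff mult_right.diff matrix_mul_assoc
        algebra_simps)
  also have "\<dots> = ?S (\<lambda>x y. u ** (f x ** y)) + ?S (\<lambda>x y. u ** (f y ** x)) - ?S (\<lambda>x y. u ** f (x ** y))
      + ?S (\<lambda>x y. f (u ** (x ** y))) - ?S (\<lambda>x y. f (u ** x) ** y) - ?S (\<lambda>x y. f (u ** y) ** x)
      + ?S (\<lambda>x y. f u ** (y ** x))"
    by (simp only: sum.distrib sum_subtractf matrix_mul_assoc)
  also have "?S (\<lambda>x y. u ** (f x ** y)) = u ** K"
    by (simp add: K_def contract_def mult_right.sum)
  also have "?S (\<lambda>x y. u ** (f y ** x)) = u ** K"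
    unfolding swap[of "\<lambda>x y. u ** (f x ** y)"] by (simp add: K_def contract_def mult_right.sum)
  also have "?S (\<lambda>x y. u ** f (x ** y)) = u ** f (?S (\<lambda>x y. x ** y))"
    by (simp add: f.sum mult_right.sum)
  also have "\<dots> = mscale N (u ** f (mat 1))"
    by (simp add: sum_munit_munit N_def f.scale mult_right.scale)
  also have "?S (\<lambda>x y. f (u ** (x ** y))) = f (u ** ?S (\<lambda>x y. x ** y))"
    by (simp add: f.sum mult_right.sum)
  also have "\<dots> = mscale N (f u)"
    by (simp add: sum_munit_munit N_def f.scale mult_right.scale)
  also have "?S (\<lambda>x y. f (u ** y) ** x) = ?S (\<lambda>x y. f (u ** x) ** y)"
    by (rule swap)
  also have "?S (\<lambda>x y. f (u ** x) ** y) = ?S (\<lambda>x y. f x ** (y ** u))"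
    by (rule casimir_move[of mscale "\<lambda>x y. f x ** y"])
      (auto intro!: module_homI mat.vector_space_axioms simp: f.add f.scale mult_left.add mult_right.add
        mult_left.scale mult_right.scale)
  also have "\<dots> = K ** u"
    by (simp add: K_def contract_def mult_left.sum matrix_mul_assoc)
  also have "?S (\<lambda>x y. f u ** (y ** x)) = f u ** ?S (\<lambda>x y. x ** y)"
    unfolding swap[of "\<lambda>x y. f u ** (x ** y)"] by (simp add: mult_right.sum)
  also have "\<dots> = mscale N (f u)"
    by (simp add: sum_munit_munit N_def mult_right.scale)
  finally show ?thesis
    by (simp add: sum_apply br_def vec_eq_iff algebra_simps)
qed

lemma br_slpart: "br (slpart f) u = mscale (1 / of_nat CARD('n)) (br (contract f) (u :: 'k::field_char_0 ^ 'n::finite ^ 'n))"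
  by (simp add: slpart_def br_def mult_left.scale mult_right.scale mult_left.diff mult_right.diff
      mat.scale_right_diff_distrib)

text \<open>The identity of the module of endomorphisms is the projection \<open>P f = br (slpart f)\<close> onto the
invariants plus a combination of the Casimir operator and the central action, both of which are
null-homotopic on cocycles.\<close>

lemma endo_decomposition:
  fixes f :: "'k::field_char_0 ^ 'n::finite ^ 'n \<Rightarrow> 'k ^ 'n ^ 'n"
  assumes "module_hom mscale mscale f"
  shows "f = br (slpart f)
    + fscale mscale (1 / (2 * of_nat CARD('n))) (\<Sum>p\<in>UNIV. \<Sum>q\<in>UNIV. lact (munit p q) (lact (munit q p) f))
    + fscale mscale (1 / 2) (lact (mat 1) f)"
proof
  fix u
  show "f u = (br (slpart f)
    + fscale mscale (1 / (2 * of_nat CARD('n))) (\<Sum>p\<in>UNIV. \<Sum>q\<in>UNIV. lact (munit p q) (lact (munit q p) f))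
    + fscale mscale (1 / 2) (lact (mat 1) f)) u"
    by (simp add: fscale_apply casimir_lact[OF assms] br_slpart lact_def vec_eq_iff field_simps)
qed

section \<open>The right-symmetric complex as a complex with coefficients\<close>

text \<open>A right-symmetric cochain is regarded as a map into endomorphisms in its first argument, which is
the one argument that does not alternate.\<close>

definition curried :: "('a list \<Rightarrow> 'b) \<Rightarrow> 'a list \<Rightarrow> 'a \<Rightarrow> 'b" where
  "curried \<eta> bs = (\<lambda>u. \<eta> (u # bs))"

lemma rsym_C_Suc_iff:
  "\<eta> \<in> rsym_C (Suc k) \<longleftrightarrow> \<eta> [] = 0 \<and> curried \<eta> \<in> alt_maps (fscale mscale) k \<and>
     (\<forall>bs. module_hom mscale mscale (curried \<eta> bs))"
    (is "_ \<longleftrightarrow> ?rhs")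
proof
  assume "\<eta> \<in> rsym_C (Suc k)"
  then have len: "\<And>as. length as \<noteq> Suc k \<Longrightarrow> \<eta> as = 0"
    and hom: "\<And>as i. i < length as \<Longrightarrow> module_hom mscale mscale (\<lambda>x. \<eta> (as[i := x]))"
    and alt: "\<And>as i j. 1 \<le> i \<Longrightarrow> i < j \<Longrightarrow> j < length as \<Longrightarrow> as ! i = as ! j \<Longrightarrow> \<eta> as = 0"
    unfolding rsym_C_def multilinear_iff[OF mat.vector_space_axioms] alternating_from_def by simp_all blast
  have "curried \<eta> \<in> alt_maps (fscale mscale) k"
  proof (rule alt_mapsI[OF endo.vector_space_axioms])
    show "module_hom mscale (fscale mscale) (\<lambda>x. curried \<eta> (as[i := x]))" if "i < length as" for as i
    proof -
      have "module_hom mscale mscale (\<lambda>x. \<eta> (u # as[i := x]))" for u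
        using hom[of "Suc i" "u # as"] that by simp
      then show ?thesis
        by (simp add: module_hom_iff curried_def fun_eq_iff fscale_apply endo.module_axioms)
    qed
    show "curried \<eta> as = 0" if "i < j" "j < length as" "as ! i = as ! j" for as i j
      using alt[of "Suc i" "Suc j" "u # as" for u] that by (simp add: curried_def fun_eq_iff)
  qed (simp add: curried_def fun_eq_iff len)
  moreover have "module_hom mscale mscale (curried \<eta> bs)" for bs
    using hom[of 0 "0 # bs"] by (simp add: curried_def)
  ultimately show ?rhs
    by (simp add: len)
next
  assume ?rhs
  then have nil: "\<eta> [] = 0" and alt: "curried \<eta> \<in> alt_maps (fscale mscale) k"
    and hom: "\<And>bs. module_hom mscale mscale (curried \<eta> bs)"
    by auto
  note alt = alt_mapsD[OF endo.vector_space_axioms alt]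
  have "\<eta> as = 0" if "length as \<noteq> Suc k" for as
    using that nil alt(1)[of "tl as"] by (cases as) (auto simp: curried_def fun_eq_iff)
  moreover have "module_hom mscale mscale (\<lambda>x. \<eta> (as[i := x]))" if i: "i < length as" for as i
  proof (cases as)
    case (Cons u bs)
    show ?thesis
    proof (cases i)
      case 0
      then show ?thesis
        using hom[of bs] Cons by (simp add: curried_def)
    next
      case (Suc j)
      then have "module_hom mscale (fscale mscale) (\<lambda>x. curried \<eta> (bs[j := x]))"
        using i Cons by (intro alt) simp
      then show ?thesis
        using Suc Cons by (simp add: module_hom_iff curried_def fun_eq_iff fscale_apply mat.module_axioms)
    qed
  qed (use i in simp)
  moreover have "\<eta> as = 0" if "1 \<le> i" "i < j" "j < length as" "as ! i = as ! j" for as i j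
  proof (cases as)
    case (Cons u bs)
    then have "curried \<eta> bs = 0"
      using that by (intro alt(3)[of "i - 1" "j - 1"]) (auto simp: nth_Cons')
    then show ?thesis
      using Cons by (simp add: curried_def fun_eq_iff)
  qed (use that in simp)
  ultimately show "\<eta> \<in> rsym_C (Suc k)"
    by (auto simp: rsym_C_def multilinear_iff[OF mat.vector_space_axioms] alternating_from_def)
qed

lemma rsym_d_Nil: "rsym_d \<eta> [] = 0"
  by (simp add: rsym_d_def)

lemma rsym_d_single: "rsym_d \<eta> [u] = u ** \<eta> [] - \<eta> [] ** u"
  by (simp add: rsym_d_def)

lemma ce_d_apply: "ce_d (fscale s) act G bs u = 
     (\<Sum>i<length bs. s ((-1) ^ i) (act (bs ! i) (G (del i bs)) u)) +
     (\<Sum>i<length bs. \<Sum>j = Suc i..<length bs. s ((-1) ^ i) (G (del i (bs[j := br (bs ! i) (bs ! j)])) u))"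
  by (simp add: ce_d_def sum_apply fscale_apply)

text \<open>Under this identification the right-symmetric differential is the Chevalley--Eilenberg differential
with coefficients in the module of endomorphisms. The two differ on a single argument, where
\<open>rsym_d\<close> takes commutators with the value of a cochain of degree 0.\<close>

lemma rsym_d_Cons:
  assumes "bs \<noteq> []"
  shows "rsym_d \<eta> (u # bs) = ce_d (fscale mscale) lact (curried \<eta>) bs u"
  unfolding ce_d_apply rsym_d_def length_Cons One_nat_def Suc_eq_plus1[symmetric]
    sum.atLeast_Suc_lessThan_Suc_shift
  using assms by (simp add: lact_def curried_def lessThan_atLeast0 sum.atLeast_Suc_lessThan_Suc_shift
      del: sum.op_ivl_Suc)

lemma ce_d_Nil [simp]: "ce_d s act G [] = 0"
  by (simp add: ce_d_def)

lemma rsym_d_Cons':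
  assumes "\<eta> [] = 0"
  shows "rsym_d \<eta> (u # bs) = ce_d (fscale mscale) lact (curried \<eta>) bs u"
  using assms by (cases "bs = []") (simp_all add: rsym_d_Cons rsym_d_single)

lemma rsym_d_eq_0_iff:
  assumes "\<eta> [] = 0"
  shows "rsym_d \<eta> = 0 \<longleftrightarrow> (\<forall>bs. ce_d (fscale mscale) lact (curried \<eta>) bs = 0)"
proof
  show "\<forall>bs. ce_d (fscale mscale) lact (curried \<eta>) bs = 0" if "rsym_d \<eta> = 0"
    using that by (auto simp: fun_eq_iff rsym_d_Cons'[where \<eta> = \<eta>, OF assms, symmetric])
  show "rsym_d \<eta> = 0" if "\<forall>bs. ce_d (fscale mscale) lact (curried \<eta>) bs = 0"
  proof
    show "rsym_d \<eta> as = 0 as" for as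
      using that by (cases as) (simp_all add: rsym_d_Nil rsym_d_Cons'[where \<eta> = \<eta>, OF assms])
  qed
qed

lemma module_hom_rsym_d:
  "module_hom (fscale mscale) (fscale mscale) (rsym_d :: (('k::field ^ 'n ^ 'n) list \<Rightarrow> _) \<Rightarrow> _)"
  by (rule module_homI) (simp_all add: endo.vector_space_axioms rsym_d_def fun_eq_iff fscale_apply
      mult_left.add mult_right.add mult_left.scale mult_right.scale sum.distrib
      mat.scale_right_distrib mat.scale_right_diff_distrib mat.scale_sum_right mult.commute
      sum_subtractf sum_negf algebra_simps)

lemma vector_space_times: "vector_space ((*) :: 'k::field \<Rightarrow> 'k \<Rightarrow> 'k)"
  by unfold_locales (simp_all add: algebra_simps)

interpretation scalar: vector_space "fscale (*) :: 'k::field \<Rightarrow> ('a \<Rightarrow> 'k) \<Rightarrow> 'a \<Rightarrow> 'k"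
  by (rule vector_space_fscale[OF vector_space_times])

lemma module_hom_lie_d: "module_hom (fscale (*)) (fscale (*)) (lie_d :: (('k::field ^ 'n ^ 'n) list \<Rightarrow> _) \<Rightarrow> _)"
  by (rule module_homI) (simp_all add: scalar.vector_space_axioms lie_d_def fun_eq_iff fscale_apply
      sum.distrib sum_distrib_left algebra_simps)

section \<open>Cup products and components of a cochain along sl\<close>

lemma curried_cup: "curried (cup f \<psi>) bs = fscale mscale (\<psi> bs) (curried f [])"
  by (simp add: curried_def cup_def fun_eq_iff fscale_apply)

lemma rsym_Z_1_iff:
  fixes f :: "('k::field ^ 'n ^ 'n) list \<Rightarrow> 'k ^ 'n ^ 'n"
  shows "f \<in> rsym_Z (Suc 0) \<longleftrightarrow> f \<in> rsym_C (Suc 0) \<and> (\<forall>a. lact a (curried f []) = 0)"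
proof (cases "f \<in> rsym_C (Suc 0)")
  case True
  then have f: "f [] = 0" "curried f \<in> alt_maps (fscale mscale) 0"
    by (auto simp: rsym_C_Suc_iff)
  have zero: "curried f bs = 0" if "bs \<noteq> []" for bs
    using alt_mapsD(1)[OF endo.vector_space_axioms f(2)] that by simp
  have "(\<forall>bs. ce_d (fscale mscale) lact (curried f) bs = 0) \<longleftrightarrow> (\<forall>a. lact a (curried f []) = 0)"
  proof safe
    fix a assume "\<forall>bs. ce_d (fscale mscale) lact (curried f) bs = 0"
    then have "ce_d (fscale mscale) lact (curried f) [a] = 0"
      by blast
    then show "lact a (curried f []) = 0"
      by (simp add: ce_d_def del_def)
  next
    fix bs :: "('k ^ 'n ^ 'n) list" assume "\<forall>a. lact a (curried f []) = 0"
    then have "lact (bs ! i) (curried f (del i bs)) = 0" for i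
      by (cases "del i bs = []") (simp_all add: zero lact.zero)
    moreover have "curried f (del i (bs[j := x])) = 0" if "i < j" "j < length bs" for i j x
    proof (rule zero)
      have "length (del i (bs[j := x])) \<noteq> 0"
        using that by simp
      then show "del i (bs[j := x]) \<noteq> []"
        by fastforce
    qed
    ultimately show "ce_d (fscale mscale) lact (curried f) bs = 0"
      by (simp add: ce_d_def)
  qed
  then show ?thesis
    using True by (simp add: rsym_Z_def rsym_d_eq_0_iff[where \<eta> = f, OF f(1)])
qed (simp add: rsym_Z_def)

text \<open>Since \<open>f\<close> is invariant, \<open>c \<mapsto> c \<cdot> f\<close> is an equivariant map from the trivial module to the module of
endomorphisms, and the cup product with \<open>f\<close> is composition with it.\<close>

lemma rsym_d_cup:
  assumes "f \<in> rsym_Z (Suc 0)"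
  shows "rsym_d (cup f \<psi>) = cup f (lie_d \<psi>)"
proof
  fix as
  show "rsym_d (cup f \<psi>) as = cup f (lie_d \<psi>) as"
  proof (cases as)
    case (Cons u bs)
    have "fscale mscale (ce_d (*) (\<lambda>_ _. 0) \<psi> bs) (curried f []) =
        ce_d (fscale mscale) lact (\<lambda>bs. fscale mscale (\<psi> bs) (curried f [])) bs"
      using assms
      by (intro ce_d_natural module_homI) (auto simp: vector_space_times endo.vector_space_axioms
          endo.scale_left_distrib lact.scale rsym_Z_1_iff)
    then have "rsym_d (cup f \<psi>) (u # bs) = fscale mscale (lie_d \<psi> bs) (curried f []) u"
      by (simp add: rsym_d_Cons' cup_def curried_cup[abs_def] lie_d_eq_ce_d)
    then show ?thesis
      by (simp add: Cons cup_def fscale_apply curried_def)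
  qed (simp add: rsym_d_Nil cup_def)
qed

lemma lie_C_eq: "lie_C k = alt_maps (*) k"
  by (simp add: lie_C_def alt_maps_def)

lemma cup_in_rsym_C:
  assumes f: "f \<in> rsym_C (Suc 0)" and \<psi>: "\<psi> \<in> lie_C k"
  shows "cup f \<psi> \<in> rsym_C (Suc k)"
  unfolding rsym_C_Suc_iff curried_cup[abs_def]
proof (intro conjI allI)
  have "module_hom (*) (fscale mscale) (\<lambda>c. fscale mscale c (curried f []))"
    by (rule module_homI)
      (simp_all add: vector_space_times endo.vector_space_axioms endo.scale_left_distrib)
  then show "(\<lambda>bs. fscale mscale (\<psi> bs) (curried f [])) \<in> alt_maps (fscale mscale) k"
    using \<psi> endo.vector_space_axioms unfolding lie_C_eq
    by (rule alt_maps_postcompose[OF vector_space_times])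
  fix bs
  interpret f: module_hom mscale mscale "curried f []"
    using f by (simp add: rsym_C_Suc_iff)
  show "module_hom mscale mscale (fscale mscale (\<psi> bs) (curried f []))"
    by (rule module_homI) (auto simp: mat.vector_space_axioms fscale_apply f.add f.scale
        mat.scale_right_distrib mult.commute)
qed (simp add: cup_def)

text \<open>The matrix entries of \<open>slpart\<close>, applied to the values of a cochain. These are the extensions to
cochains of the coordinates of a derivation with respect to the frame \<open>ad (sl_unit i)\<close>.\<close>

definition sl_component :: "'n \<times> 'n \<Rightarrow> (('k::field ^ 'n::finite ^ 'n) list \<Rightarrow> 'k ^ 'n ^ 'n) \<Rightarrow> ('k ^ 'n ^ 'n) list \<Rightarrow> 'k" where
  "sl_component i \<eta> bs = slpart (curried \<eta> bs) $ fst i $ snd i"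

lemma module_hom_slpart_component:
  "module_hom (fscale mscale) (*) (\<lambda>f :: 'k::field ^ 'n::finite ^ 'n \<Rightarrow> _. slpart f $ p $ q)"
  by (rule module_homI) (simp_all add: endo.vector_space_axioms vector_space_times slpart.add slpart.scale)

lemma module_hom_sl_component:
  "module_hom (fscale mscale) (fscale (*)) (sl_component i :: (('k::field ^ 'n::finite ^ 'n) list \<Rightarrow> _) \<Rightarrow> _)"
proof -
  have "curried (\<eta> + \<eta>') bs = curried \<eta> bs + curried \<eta>' bs"
    "curried (fscale mscale c \<eta>) bs = fscale mscale c (curried \<eta> bs)"
    for \<eta> \<eta>' :: "('k ^ 'n ^ 'n) list \<Rightarrow> 'k ^ 'n ^ 'n" and c bs
    by (simp_all add: curried_def fun_eq_iff fscale_apply)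
  then show ?thesis
    by (intro module_homI ext) (simp_all add: endo.vector_space_axioms scalar.vector_space_axioms
        sl_component_def fscale_apply[of "(*)"] slpart.add slpart.scale)
qed

lemma sl_component_cup: "sl_component i (cup f \<psi>) = fscale (*) (sl_component i f []) \<psi>"
  by (simp add: fun_eq_iff sl_component_def curried_cup slpart.scale fscale_apply)

lemma sl_component_in_lie_C:
  assumes "\<eta> \<in> rsym_C (Suc k)"
  shows "sl_component i \<eta> \<in> lie_C k"
  using alt_maps_postcompose[OF endo.vector_space_axioms module_hom_slpart_component _ vector_space_times, of "curried \<eta>" k] assms
  by (simp add: rsym_C_Suc_iff lie_C_eq sl_component_def[abs_def])

text \<open>By \<open>slpart_lact\<close> the entries of \<open>slpart\<close> are equivariant maps to the trivial module.\<close>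

lemma sl_component_rsym_d:
  fixes \<eta> :: "('k::field_char_0 ^ 'n::finite ^ 'n) list \<Rightarrow> _"
  assumes "\<eta> \<in> rsym_C (Suc k)"
  shows "sl_component i (rsym_d \<eta>) = lie_d (sl_component i \<eta>)"
proof
  fix bs
  have nil: "\<eta> [] = 0" and hom: "\<And>bs. module_hom mscale mscale (curried \<eta> bs)"
    using assms by (auto simp: rsym_C_Suc_iff)
  have "curried (rsym_d \<eta>) bs = ce_d (fscale mscale) lact (curried \<eta>) bs"
    by (simp add: curried_def[of "rsym_d \<eta>"] rsym_d_Cons'[where \<eta> = \<eta>, OF nil])
  then show "sl_component i (rsym_d \<eta>) bs = lie_d (sl_component i \<eta>) bs"
    unfolding sl_component_def[abs_def] lie_d_eq_ce_d
    using ce_d_natural[OF module_hom_slpart_component, where act = lact and act' = "\<lambda>_ _. 0" and G = "curried \<eta>" and p1 = "fst i" and q1 = "snd i" and bs = bs]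
    by (simp add: slpart_lact[OF hom])
qed

text \<open>The projections of the matrix units to traceless matrices span these, with the matrix entries as
coordinates; they form a frame, though not a basis.\<close>

definition sl_unit :: "'n \<times> 'n \<Rightarrow> 'k::field ^ 'n::finite ^ 'n" where
  "sl_unit i = munit (fst i) (snd i) - mscale (trace (munit (fst i) (snd i) :: 'k ^ 'n ^ 'n) / of_nat CARD('n)) (mat 1)"

lemma sl_unit_in_sl: "sl_unit i \<in> (sl :: ('k::field_char_0 ^ 'n::finite ^ 'n) set)"
  by (simp add: sl_def sl_unit_def trace_sub trace_mscale trace_I)

lemma matrix_eq_sum_munit: "X = (\<Sum>i\<in>UNIV. mscale (X $ fst i $ snd i) (munit (fst i) (snd i)))"
proof -
  have "(\<Sum>i\<in>UNIV. X $ fst i $ snd i * munit (fst i) (snd i) $ a $ b) =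
      (\<Sum>i\<in>UNIV. if i = (a, b) then X $ a $ b else 0)" for a b
    by (rule sum.cong) (auto simp: munit_def prod_eq_iff)
  then show ?thesis
    by (simp add: vec_eq_iff)
qed

lemma br_eq_sum_sl_unit:
  "br X u = (\<Sum>i\<in>UNIV. mscale (X $ fst i $ snd i) (br (sl_unit i) (u :: 'k::field_char_0 ^ 'n::finite ^ 'n)))"
proof -
  have "br (sl_unit i) u = br (munit (fst i) (snd i)) u" for i
    by (simp add: sl_unit_def br_def mult_left.diff mult_right.diff mult_left.scale mult_right.scale)
  then have "(\<Sum>i\<in>UNIV. mscale (X $ fst i $ snd i) (br (sl_unit i) u)) =
     br (\<Sum>i\<in>UNIV. mscale (X $ fst i $ snd i) (munit (fst i) (snd i))) u"
    by (simp add: br_def mult_left.sum mult_right.sum mult_left.scale mult_right.scale sum_subtractf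
       mat.scale_right_diff_distrib)
  then show ?thesis
    by (simp add: matrix_eq_sum_munit[symmetric])
qed

lemma curried_ad: "curried (ad X) [] = br X"
  by (simp add: curried_def ad_def fun_eq_iff)

lemma sum_cup_sl_component:
  fixes \<eta> :: "('k::field_char_0 ^ 'n::finite ^ 'n) list \<Rightarrow> _"
  shows "(\<Sum>i\<in>UNIV. cup (ad (sl_unit i)) (sl_component i \<eta>)) as =
    (case as of [] \<Rightarrow> 0 | u # bs \<Rightarrow> br (slpart (curried \<eta> bs)) u)"
proof (cases as)
  case (Cons u bs)
  then show ?thesis
    unfolding br_eq_sum_sl_unit[of "slpart (curried \<eta> _)"]
    by (simp add: sum_apply cup_def sl_component_def ad_def)
qed (simp add: sum_apply cup_def)

section \<open>A homotopy onto the derivation-valued cochains\<close>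

text \<open>The coefficients are those of the decomposition of the identity in \<open>endo_decomposition\<close>.\<close>

definition homotopy :: "(('k::field ^ 'n::finite ^ 'n) list \<Rightarrow> 'k ^ 'n ^ 'n) \<Rightarrow> ('k ^ 'n ^ 'n) list \<Rightarrow> 'k ^ 'n ^ 'n" where
  "homotopy \<eta> as = (case as of [] \<Rightarrow> 0 | u # cs \<Rightarrow>
     (fscale mscale (1 / (2 * of_nat CARD('n)))
        (\<Sum>p\<in>UNIV. \<Sum>q\<in>UNIV. lact (munit p q) (curried \<eta> (munit q p # cs)))
      + fscale mscale (1 / 2) (curried \<eta> (mat 1 # cs))) u)"

lemma curried_homotopy:
  fixes \<eta> :: "('k::field ^ 'n::finite ^ 'n) list \<Rightarrow> 'k ^ 'n ^ 'n"
  shows "curried (homotopy \<eta>) =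
    fscale (fscale mscale) (1 / (2 * of_nat CARD('n)))
      (\<lambda>cs. \<Sum>p\<in>UNIV. \<Sum>q\<in>UNIV. lact (munit p q) (curried \<eta> (munit q p # cs)))
    + fscale (fscale mscale) (1 / 2) (\<lambda>cs. curried \<eta> (mat 1 # cs))"
  by (rule ext)+ (simp add: curried_def[of "homotopy \<eta>"] homotopy_def fscale_apply)

lemma subspace_module_hom:
  "endo.subspace {f :: 'k::field ^ 'n ^ 'n \<Rightarrow> 'k ^ 'n ^ 'n. module_hom mscale mscale f}"
  by (rule endo.subspaceI) (auto intro!: module_homI mat.vector_space_axioms
      simp: fscale_apply module_hom_iff mat.module_axioms mat.scale_right_distrib mult.commute)

lemma homotopy_in_rsym_C:
  fixes \<eta> :: "('k::field ^ 'n::finite ^ 'n) list \<Rightarrow> 'k ^ 'n ^ 'n"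
  assumes "\<eta> \<in> rsym_C (Suc (Suc k))"
  shows "homotopy \<eta> \<in> rsym_C (Suc k)"
proof -
  interpret EE: vector_space "fscale (fscale mscale) :: 'k \<Rightarrow> (('k ^ 'n ^ 'n) list \<Rightarrow> 'k ^ 'n ^ 'n \<Rightarrow> 'k ^ 'n ^ 'n) \<Rightarrow> _"
    by (rule vector_space_fscale[OF endo.vector_space_axioms])
  note sub = subspace_alt_maps[OF endo.vector_space_axioms]
  have alt: "curried \<eta> \<in> alt_maps (fscale mscale) (Suc k)"
    and hom: "\<And>bs. module_hom mscale mscale (curried \<eta> bs)"
    using assms by (auto simp: rsym_C_Suc_iff)
  have summand: "(\<lambda>cs. lact y (curried \<eta> (x # cs))) \<in> alt_maps (fscale mscale) k" for x y
    by (rule alt_maps_postcompose[OF endo.vector_space_axioms lact.module_hom_axioms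
        alt_maps_Cons[OF endo.vector_space_axioms alt] endo.vector_space_axioms])
  have "(\<lambda>cs. \<Sum>p\<in>UNIV. \<Sum>q\<in>UNIV. lact (munit p q) (curried \<eta> (munit q p # cs))) =
      (\<Sum>p\<in>UNIV. \<Sum>q\<in>UNIV. (\<lambda>cs. lact (munit p q) (curried \<eta> (munit q p # cs))))"
    by (rule ext) (simp add: sum_apply)
  then have "curried (homotopy \<eta>) \<in> alt_maps (fscale mscale) k"
    unfolding curried_homotopy
    by (simp only:) (intro EE.subspace_add[OF sub] EE.subspace_scale[OF sub] EE.subspace_sum[OF sub]
        summand alt_maps_Cons[OF endo.vector_space_axioms alt])
  moreover have "curried (homotopy \<eta>) bs \<in> {f. module_hom mscale mscale f}" for bs
  proof -
    have "curried (homotopy \<eta>) bs = fscale mscale (1 / (2 * of_nat CARD('n)))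
        (\<Sum>p\<in>UNIV. \<Sum>q\<in>UNIV. lact (munit p q) (curried \<eta> (munit q p # bs)))
      + fscale mscale (1 / 2) (curried \<eta> (mat 1 # bs))"
      by (simp add: curried_homotopy fscale_apply[of "fscale mscale"])
    then show ?thesis
      by (simp only:, intro endo.subspace_add[OF subspace_module_hom] endo.subspace_scale[OF subspace_module_hom]
        endo.subspace_sum[OF subspace_module_hom],
        simp_all only: mem_Collect_eq module_hom_lact hom)
  qed
  ultimately show ?thesis
    by (simp add: rsym_C_Suc_iff homotopy_def)
qed

lemma ce_d_add:
  assumes "vector_space s" "\<And>a. module_hom s s (act a)"
  shows "ce_d s act (F + G) bs = ce_d s act F bs + ce_d s act G bs"
proof -
  interpret vector_space s by fact
  interpret act: module_hom s s "act a" for a by fact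
  show ?thesis
    by (simp add: ce_d_def act.add scale_right_distrib sum.distrib algebra_simps)
qed

lemma ce_d_scale:
  assumes "vector_space s" "\<And>a. module_hom s s (act a)"
  shows "ce_d s act (fscale s c F) bs = s c (ce_d s act F bs)"
proof -
  interpret vector_space s by fact
  interpret act: module_hom s s "act a" for a by fact
  show ?thesis
    by (simp add: ce_d_def fscale_apply act.scale scale_right_distrib scale_sum_right mult.commute)
qed

text \<open>A cocycle is cohomologous to its projection to derivation-valued cochains. The projection has
the form of a sum of cup products, as the values of \<open>slpart\<close> are combinations of the
matrices \<open>sl_unit i\<close>.\<close>

lemma homotopy_formula:
  fixes \<eta> :: "('k::field_char_0 ^ 'n::finite ^ 'n) list \<Rightarrow> 'k ^ 'n ^ 'n"
  assumes "\<eta> \<in> rsym_Z (Suc (Suc k))"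
  shows "rsym_d (homotopy \<eta>) = \<eta> - (\<Sum>i\<in>UNIV. cup (ad (sl_unit i)) (sl_component i \<eta>))"
proof
  fix as
  have nil: "\<eta> [] = 0" and alt: "curried \<eta> \<in> alt_maps (fscale mscale) (Suc k)"
    and hom: "\<And>bs. module_hom mscale mscale (curried \<eta> bs)"
    and cocycle: "ce_d (fscale mscale) lact (curried \<eta>) bs = 0" for bs
    using assms by (auto simp: rsym_Z_def rsym_C_Suc_iff rsym_d_eq_0_iff[where \<eta> = \<eta>])
  have nil': "homotopy \<eta> [] = 0"
    by (simp add: homotopy_def)
  show "rsym_d (homotopy \<eta>) as = (\<eta> - (\<Sum>i\<in>UNIV. cup (ad (sl_unit i)) (sl_component i \<eta>))) as"
  proof (cases as)
    case Nil
    then show ?thesis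
      by (simp add: sum_cup_sl_component nil rsym_d_Nil)
  next
    case (Cons u bs)
    note ce_d = ce_d_add[OF endo.vector_space_axioms lact.module_hom_axioms]
      ce_d_scale[OF endo.vector_space_axioms lact.module_hom_axioms]
    have "ce_d (fscale mscale) lact (curried (homotopy \<eta>)) bs =
      fscale mscale (1 / (2 * of_nat CARD('n)))
        (\<Sum>p\<in>UNIV. \<Sum>q\<in>UNIV. lact (munit p q) (lact (munit q p) (curried \<eta> bs)))
      + fscale mscale (1 / 2) (lact (mat 1) (curried \<eta> bs))"
      unfolding curried_homotopy ce_d
      by (simp only: casimir_homotopy[OF endo.vector_space_axioms alt lact.module_hom_axioms
            module_hom_lact_left[OF hom] lact_br[OF hom] cocycle]
          central_homotopy[OF endo.vector_space_axioms alt cocycle])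
    also have "\<dots> = curried \<eta> bs - br (slpart (curried \<eta> bs))"
      using endo_decomposition[OF hom[of bs]] by (simp add: algebra_simps)
    finally show ?thesis
      by (simp add: Cons sum_cup_sl_component rsym_d_Cons'[where \<eta> = "homotopy \<eta>", OF nil'] curried_def)
  qed
qed

section \<open>Derivations of the matrix algebra\<close>

text \<open>In degree 1 there is no room for a homotopy, but derivations are annihilated by the action and hence
equal to their projection. This is the fact that every derivation of the matrix algebra is inner.\<close>

lemma rsym_Z_1_eq_sum_cup:
  fixes f :: "('k::field_char_0 ^ 'n::finite ^ 'n) list \<Rightarrow> 'k ^ 'n ^ 'n"
  assumes "f \<in> rsym_Z (Suc 0)"
  shows "f = (\<Sum>i\<in>UNIV. cup (ad (sl_unit i)) (sl_component i f))"
proof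
  fix as
  have nil: "f [] = 0" and alt: "curried f \<in> alt_maps (fscale mscale) 0"
    and hom: "\<And>bs. module_hom mscale mscale (curried f bs)"
    and lact: "\<And>a. lact a (curried f []) = 0"
    using assms by (auto simp: rsym_Z_1_iff rsym_C_Suc_iff)
  have "curried f bs = br (slpart (curried f bs))" for bs
  proof (cases "bs = []")
    case True
    then show ?thesis
      using endo_decomposition[OF hom[of "[]"]] by (simp add: lact lact.zero)
  next
    case False
    then have "curried f bs = 0"
      using alt_mapsD(1)[OF endo.vector_space_axioms alt] by simp
    then show ?thesis
      by (simp add: slpart.zero) (simp add: br_def fun_eq_iff)
  qed
  then have "f (u # bs) = br (slpart (curried f bs)) u" for u bs
    by (metis curried_def)
  then show "f as = (\<Sum>i\<in>UNIV. cup (ad (sl_unit i)) (sl_component i f)) as"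
    by (simp add: sum_cup_sl_component nil split: list.split)
qed

lemma module_hom_br: "module_hom mscale mscale (br (X :: 'k::field ^ 'n ^ 'n))"
  by (rule module_homI) (simp_all add: mat.vector_space_axioms br_def mult_left.add mult_right.add
      mult_left.scale mult_right.scale mat.scale_right_diff_distrib)

lemma ad_in_rsym_Z: "ad X \<in> rsym_Z (Suc 0)"
proof -
  have curried: "curried (ad X) bs = (if bs = [] then br X else 0)" for bs
    by (simp add: curried_def ad_def fun_eq_iff)
  have "curried (ad X) \<in> alt_maps (fscale mscale) 0"
    by (rule alt_mapsI[OF endo.vector_space_axioms])
      (auto simp: curried intro!: module_homI mat.vector_space_axioms endo.vector_space_axioms)
  moreover have "module_hom mscale mscale (curried (ad X) bs)" for bs
    using module_hom_br[of X] by (auto simp: curried intro!: module_homI mat.vector_space_axioms)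
  moreover have "lact a (br X) = 0" for a
    by (simp add: fun_eq_iff lact_def br_def mult_left.diff mult_right.diff matrix_mul_assoc)
  ultimately show ?thesis
    by (simp add: rsym_Z_1_iff rsym_C_Suc_iff curried ad_def[of X "[]"])
qed

lemma cup_in_rsym_Z:
  assumes f: "f \<in> rsym_Z (Suc 0)" and \<psi>: "\<psi> \<in> lie_Z k"
  shows "cup f \<psi> \<in> rsym_Z (Suc k)"
  using rsym_d_cup[OF f, of \<psi>] cup_in_rsym_C[of f \<psi> k] f \<psi>
  by (auto simp: rsym_Z_def lie_Z_def cup_def fun_eq_iff split: list.split)

lemma viso_ad:
  "viso (vsub mscale sl) (rsym_Z_space 1)
     (ad :: 'k::field_char_0 ^ 'n::finite ^ 'n \<Rightarrow> ('k ^ 'n ^ 'n) list \<Rightarrow> 'k ^ 'n ^ 'n)"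
proof -
  have "bij_betw (ad :: 'k ^ 'n ^ 'n \<Rightarrow> _) sl (rsym_Z (Suc 0))"
  proof (rule bij_betw_byWitness[where f' = "\<lambda>f. slpart (curried f [])"])
    show "\<forall>X\<in>sl. slpart (curried (ad X) []) = (X :: 'k ^ 'n ^ 'n)"
      by (simp add: curried_ad slpart_br)
    show "\<forall>f\<in>rsym_Z (Suc 0). ad (slpart (curried f [])) = (f :: ('k ^ 'n ^ 'n) list \<Rightarrow> _)"
    proof (intro ballI ext)
      fix f :: "('k ^ 'n ^ 'n) list \<Rightarrow> 'k ^ 'n ^ 'n" and as
      assume f: "f \<in> rsym_Z (Suc 0)"
      have "f as = 0" if "length as \<noteq> 1"
        using f that by (auto simp: rsym_Z_def rsym_C_def multilinear_def)
      moreover have "f [u] = br (slpart (curried f [])) u" for u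
        by (subst (1) rsym_Z_1_eq_sum_cup[OF f]) (simp add: sum_cup_sl_component)
      ultimately show "ad (slpart (curried f [])) as = f as"
        by (auto simp: ad_def length_Suc_conv)
    qed
  qed (auto simp: ad_in_rsym_Z slpart_in_sl)
  then show ?thesis
    by (auto simp: viso_def vlinear_def vsub_def rsym_Z_space_def ad_in_rsym_Z fun_eq_iff fscale_apply
        ad_def br_def mult_left.add mult_right.add mult_left.scale mult_right.scale
        mat.scale_right_diff_distrib)
qed

section \<open>Cohomology\<close>

lemma subspace_rsym_C: "endo.subspace (rsym_C k :: (('k::field ^ 'n ^ 'n) list \<Rightarrow> 'k ^ 'n ^ 'n) set)"
proof (cases k)
  case 0
  then show ?thesis
    by (intro endo.subspaceI) (auto simp: rsym_C_def multilinear_def fscale_apply matrix_mul_assoc)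
next
  case (Suc l)
  interpret EE: vector_space "fscale (fscale mscale) :: 'k \<Rightarrow> (('k ^ 'n ^ 'n) list \<Rightarrow> 'k ^ 'n ^ 'n \<Rightarrow> 'k ^ 'n ^ 'n) \<Rightarrow> _"
    by (rule vector_space_fscale[OF endo.vector_space_axioms])
  have curried: "curried (0 :: ('k ^ 'n ^ 'n) list \<Rightarrow> 'k ^ 'n ^ 'n) = 0"
    "curried (\<eta> + \<eta>') = curried \<eta> + curried \<eta>'"
    "curried (fscale mscale c \<eta>) = fscale (fscale mscale) c (curried \<eta>)"
    for \<eta> \<eta>' :: "('k ^ 'n ^ 'n) list \<Rightarrow> 'k ^ 'n ^ 'n" and c
    by (simp_all add: curried_def fun_eq_iff fscale_apply)
  note sub = subspace_alt_maps[OF endo.vector_space_axioms, of l]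
  note hom = subspace_module_hom
  show ?thesis
    unfolding Suc
    using EE.subspace_0[OF sub] endo.subspace_0[OF hom]
    by (intro endo.subspaceI)
      (auto simp: rsym_C_Suc_iff curried fscale_apply[of _ _ _ "[]"] fscale_apply[of "fscale mscale"]
        intro: EE.subspace_add[OF sub] EE.subspace_scale[OF sub]
          endo.subspace_add[OF hom, unfolded mem_Collect_eq] endo.subspace_scale[OF hom, unfolded mem_Collect_eq])
qed

lemma subspace_rsym_Z: "endo.subspace (rsym_Z k)"
  using endo.subspace_inter[OF subspace_rsym_C module_hom.subspace_kernel[OF module_hom_rsym_d]]
  by (simp add: rsym_Z_def Int_def)

lemma subspace_rsym_B: "endo.subspace (rsym_B k)"
  by (cases k) (simp_all add: rsym_B_def module_hom.subspace_image[OF module_hom_rsym_d subspace_rsym_C])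

lemma subspace_lie_C: "scalar.subspace (lie_C k)"
  unfolding lie_C_eq by (rule subspace_alt_maps[OF vector_space_times])

lemma subspace_lie_Z: "scalar.subspace (lie_Z k)"
  using scalar.subspace_inter[OF subspace_lie_C module_hom.subspace_kernel[OF module_hom_lie_d]]
  by (simp add: lie_Z_def Int_def)

lemma subspace_lie_B: "scalar.subspace (lie_B k)"
  by (cases k) (simp_all add: lie_B_def module_hom.subspace_image[OF module_hom_lie_d subspace_lie_C])

lemma sl_component_in_lie_Z:
  fixes \<eta> :: "('k::field_char_0 ^ 'n::finite ^ 'n) list \<Rightarrow> 'k ^ 'n ^ 'n"
  assumes "\<eta> \<in> rsym_Z (Suc k)"
  shows "sl_component i \<eta> \<in> lie_Z k"
  using assms sl_component_rsym_d[of \<eta> k i] sl_component_in_lie_C[of \<eta> k i]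
  by (auto simp: rsym_Z_def lie_Z_def module_hom.zero[OF module_hom_sl_component])

lemma cup_lie_B:
  assumes f: "f \<in> rsym_Z (Suc 0)" and k: "k \<ge> 1" and \<psi>: "\<psi> \<in> lie_B k"
  shows "cup f \<psi> \<in> rsym_B (Suc k)"
proof -
  obtain l where l: "k = Suc l"
    using k by (cases k) auto
  then obtain \<phi> where \<phi>: "\<phi> \<in> lie_C l" "\<psi> = lie_d \<phi>"
    using \<psi> by (auto simp: lie_B_def)
  have "cup f \<phi> \<in> rsym_C k"
    using f \<phi> cup_in_rsym_C[of f \<phi> l] l by (simp add: rsym_Z_def)
  then show ?thesis
    using rsym_d_cup[OF f, of \<phi>] \<phi> by (auto simp: rsym_B_def intro!: image_eqI[of _ _ "cup f \<phi>"])
qed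

lemma sl_component_rsym_B:
  fixes \<eta> :: "('k::field_char_0 ^ 'n::finite ^ 'n) list \<Rightarrow> 'k ^ 'n ^ 'n"
  assumes k: "k \<ge> 1" and \<eta>: "\<eta> \<in> rsym_B (Suc k)"
  shows "sl_component i \<eta> \<in> lie_B k"
proof -
  obtain l where l: "k = Suc l"
    using k by (cases k) auto
  then obtain \<theta> where "\<theta> \<in> rsym_C (Suc l)" "\<eta> = rsym_d \<theta>"
    using \<eta> by (auto simp: rsym_B_def)
  then show ?thesis
    by (simp add: l lie_B_def sl_component_rsym_d sl_component_in_lie_C)
qed

lemma sum_cup_cohomologous:
  fixes \<eta> :: "('k::field_char_0 ^ 'n::finite ^ 'n) list \<Rightarrow> 'k ^ 'n ^ 'n"
  assumes k: "k \<ge> 1" and \<eta>: "\<eta> \<in> rsym_Z (Suc k)"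
  shows "\<eta> - (\<Sum>i\<in>UNIV. cup (ad (sl_unit i)) (sl_component i \<eta>)) \<in> rsym_B (Suc k)"
proof -
  obtain l where l: "k = Suc l"
    using k by (cases k) auto
  have "\<eta> - (\<Sum>i\<in>UNIV. cup (ad (sl_unit i)) (sl_component i \<eta>)) = rsym_d (homotopy \<eta>)"
    using \<eta> l by (simp add: homotopy_formula)
  moreover have "homotopy \<eta> \<in> rsym_C k"
    using homotopy_in_rsym_C[of \<eta> l] \<eta> l by (simp add: rsym_Z_def)
  ultimately show ?thesis
    by (simp add: rsym_B_def)
qed

text \<open>The subspace \<open>B\<close> that is divided out is a parameter because of degree 1: there all cocycles are
coboundaries, and the isomorphism holds with \<open>B = {0}\<close>. In higher degrees \<open>B\<close> consists of the
coboundaries.\<close>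

lemma cup_viso:
  fixes B :: "(('k::field_char_0 ^ 'n::finite ^ 'n) list \<Rightarrow> 'k ^ 'n ^ 'n) set"
  assumes B: "endo.subspace B"
    and cup_B: "\<And>f \<psi>. f \<in> rsym_Z (Suc 0) \<Longrightarrow> \<psi> \<in> lie_B k \<Longrightarrow> cup f \<psi> \<in> B"
    and comp_B: "\<And>i \<eta>. \<eta> \<in> B \<Longrightarrow> sl_component i \<eta> \<in> lie_B k"
    and cohomologous: "\<And>\<eta>. \<eta> \<in> rsym_Z (Suc k) \<Longrightarrow> \<eta> - (\<Sum>i\<in>UNIV. cup (ad (sl_unit i)) (sl_component i \<eta>)) \<in> B"
  shows "\<exists>\<Phi>. viso (tensor (rsym_Z_space 1) (lie_H k)) (vquot (fscale mscale) (rsym_Z (Suc k)) B) \<Phi> \<and>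
    induced_by_cup k (\<lambda>z. z +o B) \<Phi>"
proof -
  have frame: "f = (\<Sum>i\<in>UNIV. fscale mscale (sl_component i f []) (ad (sl_unit i)))"
    if "f \<in> rsym_Z (Suc 0)" for f :: "('k ^ 'n ^ 'n) list \<Rightarrow> 'k ^ 'n ^ 'n"
  proof
    fix as
    have "f as = 0" if "length as \<noteq> 1"
      using \<open>f \<in> _\<close> that by (auto simp: rsym_Z_def rsym_C_def multilinear_def)
    moreover have "f [u] = (\<Sum>i\<in>UNIV. mscale (sl_component i f []) (ad (sl_unit i) [u]))" for u
      by (subst (1) rsym_Z_1_eq_sum_cup[OF that]) (simp add: sum_apply cup_def)
    ultimately show "f as = (\<Sum>i\<in>UNIV. fscale mscale (sl_component i f []) (ad (sl_unit i))) as"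
      by (cases "length as = 1") (auto simp: sum_apply fscale_apply length_Suc_conv ad_def)
  qed
  have cup1: "module_hom (fscale mscale) (fscale mscale) (\<lambda>f. cup f \<psi>)"
    for \<psi> :: "('k ^ 'n ^ 'n) list \<Rightarrow> 'k"
    by (intro module_homI ext) (auto simp: endo.vector_space_axioms cup_def fscale_apply
        mat.scale_right_distrib mult.commute split: list.split)
  have cup2: "module_hom (fscale (*)) (fscale mscale) (cup f)"
    for f :: "('k ^ 'n ^ 'n) list \<Rightarrow> 'k ^ 'n ^ 'n"
    by (intro module_homI ext) (auto simp: endo.vector_space_axioms scalar.vector_space_axioms cup_def
        fscale_apply mat.scale_left_distrib split: list.split)
  have "\<exists>\<Phi>. viso (tensor (vsub (fscale mscale) (rsym_Z (Suc 0))) (vquot (fscale (*)) (lie_Z k) (lie_B k)))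
      (vquot (fscale mscale) (rsym_Z (Suc k)) B) \<Phi> \<and>
    (\<forall>f \<in> rsym_Z (Suc 0). \<forall>\<psi> \<in> lie_Z k. \<Phi> (pure_tensor (vsub (fscale mscale) (rsym_Z (Suc 0)))
      (vquot (fscale (*)) (lie_Z k) (lie_B k)) f (\<psi> +o lie_B k)) = cup f \<psi> +o B)"
    by (rule tensor_viso_of_frame[where I = UNIV and b = "\<lambda>i. ad (sl_unit i)" and
          e = "\<lambda>i f. sl_component i f []" and \<kappa> = sl_component,
        OF endo.vector_space_axioms scalar.vector_space_axioms endo.vector_space_axioms subspace_rsym_Z
          subspace_lie_Z subspace_lie_B subspace_rsym_Z B cup1 cup2 cup_in_rsym_Z cup_B finite
          ad_in_rsym_Z frame module_hom_sl_component sl_component_in_lie_Z comp_B sl_component_cup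
          cohomologous])
  then show ?thesis
    by (simp add: induced_by_cup_def rsym_Z_space_def lie_H_def)
qed

lemma viso_the_elem:
  assumes "module s"
  shows "viso (vquot s Z {0}) (vsub s Z) the_elem"
proof -
  interpret module s by fact
  have [simp]: "z +o {0} = {z}" for z :: 'b
    by (simp add: elt_set_plus_def)
  have [simp]: "{x} + {y} = {x + y}" for x y :: 'b
    by (simp add: set_plus_def)
  have "bij_betw the_elem ((\<lambda>z. {z}) ` Z) Z"
    by (auto simp: bij_betw_def inj_on_def image_image)
  then show ?thesis
    by (auto simp: viso_def vlinear_def vquot_def vsub_def)
qed

lemma viso_comp:
  assumes "viso U V f" "viso V W g"
  shows "viso U W (g \<circ> f)"
  using assms by (auto simp: viso_def vlinear_def intro: bij_betw_trans)

theorem theorem5p11: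
  shows
    "viso (vsub mscale sl) (rsym_Z_space 1)
        (ad :: 'k::field_char_0 ^ 'n::finite ^ 'n \<Rightarrow> ('k ^ 'n ^ 'n) list \<Rightarrow> 'k ^ 'n ^ 'n)
     \<and>
     (\<forall>k\<ge>1. \<exists>\<Phi>.
        viso
          (tensor (rsym_Z_space 1 :: ('k, ('k ^ 'n ^ 'n) list \<Rightarrow> 'k ^ 'n ^ 'n) vspace) (lie_H k))
          (rsym_H (k + 1)) \<Phi> \<and>
        induced_by_cup k (\<lambda>z. z +o rsym_B (k + 1)) \<Phi>)
     \<and>
     \<comment> \<open>\<open>k = 0\<close>: the coboundaries of degree 1 must not be divided out\<close>
     (\<exists>\<Phi>.
        viso
          (tensor (rsym_Z_space 1 :: ('k, ('k ^ 'n ^ 'n) list \<Rightarrow> 'k ^ 'n ^ 'n) vspace) (lie_H 0))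
          (rsym_Z_space 1) \<Phi> \<and>
        induced_by_cup 0 (\<lambda>z. z) \<Phi>)
     \<and>
     (\<forall>k. \<forall>C \<in> vcarrier (rsym_H (k + 1) ::
                   ('k, (('k ^ 'n ^ 'n) list \<Rightarrow> 'k ^ 'n ^ 'n) set) vspace).
        \<exists>(m::nat) X \<psi>. (\<forall>i<m. X i \<in> sl \<and> \<psi> i \<in> lie_Z k) \<and>
                 (\<Sum>i<m. cup (ad (X i)) (\<psi> i)) \<in> C)"
proof (intro conjI allI impI ballI)
  show "viso (vsub mscale sl) (rsym_Z_space 1) (ad :: 'k ^ 'n ^ 'n \<Rightarrow> _)"
    by (rule viso_ad)
next
  fix k :: nat
  assume k: "k \<ge> 1"
  show "\<exists>\<Phi>. viso (tensor (rsym_Z_space 1 :: ('k, ('k ^ 'n ^ 'n) list \<Rightarrow> 'k ^ 'n ^ 'n) vspace) (lie_H k))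
      (rsym_H (k + 1)) \<Phi> \<and> induced_by_cup k (\<lambda>z. z +o rsym_B (k + 1)) \<Phi>"
    using cup_viso[OF subspace_rsym_B cup_lie_B[OF _ k] sl_component_rsym_B[OF k] sum_cup_cohomologous[OF k]]
    by (simp add: rsym_H_def)
next
  have "\<exists>\<Phi>. viso (tensor (rsym_Z_space 1) (lie_H 0))
      (vquot (fscale mscale) (rsym_Z (Suc 0)) {0 :: ('k ^ 'n ^ 'n) list \<Rightarrow> 'k ^ 'n ^ 'n}) \<Phi> \<and>
    induced_by_cup 0 (\<lambda>z. z +o {0}) \<Phi>"
  proof (rule cup_viso)
    show "cup f \<psi> \<in> {0}" if "\<psi> \<in> lie_B 0" for f :: "('k ^ 'n ^ 'n) list \<Rightarrow> 'k ^ 'n ^ 'n" and \<psi>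
      using that by (simp add: lie_B_def cup_def fun_eq_iff split: list.split)
    show "sl_component i \<eta> \<in> lie_B 0" if "\<eta> \<in> {0}" for i and \<eta> :: "('k ^ 'n ^ 'n) list \<Rightarrow> 'k ^ 'n ^ 'n"
      using that by (simp add: lie_B_def module_hom.zero[OF module_hom_sl_component])
  qed (simp_all add: rsym_Z_1_eq_sum_cup[symmetric])
  then obtain \<Phi> where \<Phi>: "viso (tensor (rsym_Z_space 1) (lie_H 0))
      (vquot (fscale mscale) (rsym_Z (Suc 0)) {0 :: ('k ^ 'n ^ 'n) list \<Rightarrow> 'k ^ 'n ^ 'n}) \<Phi>"
    "induced_by_cup 0 (\<lambda>z. z +o {0}) \<Phi>"
    by blast
  have "viso (tensor (rsym_Z_space 1) (lie_H 0))
      (rsym_Z_space 1 :: ('k, ('k ^ 'n ^ 'n) list \<Rightarrow> 'k ^ 'n ^ 'n) vspace) (the_elem \<circ> \<Phi>)"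
    using viso_comp[OF \<Phi>(1) viso_the_elem[OF endo.module_axioms]] by (simp add: rsym_Z_space_def)
  moreover have "induced_by_cup 0 (\<lambda>z. z) (the_elem \<circ> \<Phi>)"
    using \<Phi>(2) by (simp add: induced_by_cup_def elt_set_plus_def)
  ultimately show "\<exists>\<Phi>. viso (tensor (rsym_Z_space 1 :: ('k, ('k ^ 'n ^ 'n) list \<Rightarrow> 'k ^ 'n ^ 'n) vspace) (lie_H 0))
      (rsym_Z_space 1) \<Phi> \<and> induced_by_cup 0 (\<lambda>z. z) \<Phi>"
    by blast
next
  fix k and C :: "(('k ^ 'n ^ 'n) list \<Rightarrow> 'k ^ 'n ^ 'n) set"
  assume "C \<in> vcarrier (rsym_H (k + 1))"
  then obtain \<eta> where \<eta>: "\<eta> \<in> rsym_Z (Suc k)" and C: "C = \<eta> +o rsym_B (Suc k)"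
    by (auto simp: rsym_H_def vquot_def)
  let ?S = "\<Sum>i\<in>UNIV. cup (ad (sl_unit i)) (sl_component i \<eta>)"
  have "\<eta> - ?S \<in> rsym_B (Suc k)"
  proof (cases k)
    case 0
    then show ?thesis
      using endo.subspace_0[OF subspace_rsym_B] rsym_Z_1_eq_sum_cup[of \<eta>] \<eta> by simp
  qed (use \<eta> sum_cup_cohomologous[of k \<eta>] in simp)
  then have "?S \<in> C"
    using endo.subspace_neg[OF subspace_rsym_B] by (fastforce simp: C set_minus_plus[symmetric])
  obtain h :: "nat \<Rightarrow> 'n \<times> 'n" where h: "bij_betw h {..<CARD('n \<times> 'n)} UNIV"
    using ex_bij_betw_nat_finite[of "UNIV :: ('n \<times> 'n) set"] by (auto simp: atLeast0LessThan)
  have "(\<Sum>j<CARD('n \<times> 'n). cup (ad (sl_unit (h j))) (sl_component (h j) \<eta>)) = ?S"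
    by (rule sum.reindex_bij_betw[OF h])
  then show "\<exists>(m::nat) X \<psi>. (\<forall>i<m. X i \<in> sl \<and> \<psi> i \<in> lie_Z k) \<and>
                 (\<Sum>i<m. cup (ad (X i)) (\<psi> i)) \<in> C"
    using \<open>?S \<in> C\<close> sl_component_in_lie_Z[OF \<eta>]
    by (intro exI[of _ "CARD('n \<times> 'n)"] exI[of _ "\<lambda>j. sl_unit (h j)"]
        exI[of _ "\<lambda>j. sl_component (h j) \<eta>"]) (simp add: sl_unit_in_sl)
qed

end
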